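(* Let $\omega$ be a nonzero real number and $\lambda\in\mathbb{C}$ with $\mathrm{Re}\,\lambda\neq0$. Consider the holomorphic system $$\dot x=i\omega x+y+f,\quad \dot y=i\omega y+g,\quad \dot z=\lambda z+h,$$ where $f,g,h$ are holomorphic near $0\in\mathbb{C}^3$ and vanish to order at least $2$. Then the system has a unique $x$-invariant holomorphic center manifold at the origin, and it contains an isochronous center family of period $2\pi/|\omega|$.
   Context: An $x$-invariant holomorphic center manifold at the origin is a germ at $0$ of a one-dimensional complex submanifold of $\mathbb{C}^3$ through $0$ that is invariant under the system and tangent at $0$ to the $x$-axis. Such a manifold $S$ contains an isochronous center family of period $T$ if every real-time trajectory of the system starting at a point of $S\setminus\{0\}$ sufficiently close to $0$ is periodic of period $T$. *)

theory Defs
  imports "HOL-Analysis.Analysis"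
begin

type_synonym c3 = "complex \<times> complex \<times> complex"

definition holo3_on :: "(c3 \<Rightarrow> complex) \<Rightarrow> c3 set \<Rightarrow> bool" where
  "holo3_on f U \<longleftrightarrow> (\<forall>p\<in>U. \<exists>D. (f has_derivative D) (at p) \<and>
      (\<forall>c a b d. D (c * a, c * b, c * d) = c * D (a, b, d)))"

definition vanish2 :: "(c3 \<Rightarrow> complex) \<Rightarrow> bool" where
  "vanish2 f \<longleftrightarrow> f 0 = 0 \<and> (f has_derivative (\<lambda>_. 0)) (at 0)"

definition sys :: "real \<Rightarrow> complex \<Rightarrow> (c3 \<Rightarrow> complex) \<Rightarrow> (c3 \<Rightarrow> complex) \<Rightarrow> (c3 \<Rightarrow> complex) \<Rightarrow> c3 \<Rightarrow> c3" where
  "sys w lam f g h p = (case p of (x, y, z) \<Rightarrow>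
      (\<i> * complex_of_real w * x + y + f p, \<i> * complex_of_real w * y + g p, lam * z + h p))"

definition graph3 :: "real \<Rightarrow> (complex \<Rightarrow> complex) \<Rightarrow> (complex \<Rightarrow> complex) \<Rightarrow> c3 set" where
  "graph3 r \<phi> \<psi> = (\<lambda>x. (x, \<phi> x, \<psi> x)) ` ball 0 r"

text \<open>A representative of an x-invariant holomorphic center manifold at 0 for the vector
  field F defined on U: a one-dimensional complex submanifold through 0 tangent to the
  x-axis, written as a holomorphic graph y = phi(x), z = psi(x) near 0, contained in U,
  and invariant, i.e. F is tangent to it at each of its points (the tangent line at
  (x, phi x, psi x) is spanned by (1, phi' x, psi' x)).\<close>
definition x_center_manifold :: "(c3 \<Rightarrow> c3) \<Rightarrow> c3 set \<Rightarrow> real \<Rightarrow> (complex \<Rightarrow> complex) \<Rightarrow> (complex \<Rightarrow> complex) \<Rightarrow> bool" where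
  "x_center_manifold F U r \<phi> \<psi> \<longleftrightarrow>
     r > 0 \<and> \<phi> holomorphic_on ball 0 r \<and> \<psi> holomorphic_on ball 0 r \<and>
     \<phi> 0 = 0 \<and> \<psi> 0 = 0 \<and> deriv \<phi> 0 = 0 \<and> deriv \<psi> 0 = 0 \<and>
     graph3 r \<phi> \<psi> \<subseteq> U \<and>
     (\<forall>x\<in>ball 0 r. \<exists>c. F (x, \<phi> x, \<psi> x) = (c, c * deriv \<phi> x, c * deriv \<psi> x))"

text \<open>S contains an isochronous center family of period T: every real-time trajectory
  starting at a point of S - {0} close enough to 0 is periodic of (least) period T.
  Trajectories are solutions of u' = F u staying in the domain U.\<close>
definition isochronous_family :: "(c3 \<Rightarrow> c3) \<Rightarrow> c3 set \<Rightarrow> c3 set \<Rightarrow> real \<Rightarrow> bool" where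
  "isochronous_family F U S T \<longleftrightarrow>
     (\<exists>\<delta>>0. \<forall>p\<in>S. p \<noteq> 0 \<and> norm p < \<delta> \<longrightarrow>
        (\<exists>u. u 0 = p \<and>
             (\<forall>t. u t \<in> U \<and> (u has_vector_derivative F (u t)) (at t)) \<and>
             (\<forall>t. u (t + T) = u t) \<and>
             (\<forall>s. 0 < s \<and> s < T \<longrightarrow> u s \<noteq> p) \<and>
             (\<forall>v I. is_interval I \<and> 0 \<in> I \<and> v 0 = p \<and>
                 (\<forall>t\<in>I. v t \<in> U \<and> (v has_vector_derivative F (v t)) (at t within I))
                 \<longrightarrow> (\<forall>t\<in>I. v t = u t))))"

end

theory Submission
  imports Defs "HOL-Complex_Analysis.Complex_Analysis"
begin

text \<open>A parametrization \<open>P(\<xi>) = (\<xi> + X, Y, Z)\<close> with \<open>X, Y, Z = O(\<xi>\<^sup>2)\<close> and \<open>i w \<xi> P'(\<xi>) = F(P(\<xi>))\<close>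
  gives everything at once: its image is invariant and tangent to the \<open>x\<close>-axis, and \<open>t \<mapsto> P(e\<^bsup>iwt\<^esup> \<xi>)\<close>
  is a trajectory of period \<open>2\<pi>/|w|\<close>. Componentwise the equation reads \<open>i w \<xi> v' - \<mu> v = u\<close> with
  \<open>\<mu> = i w\<close> (twice) or \<open>\<mu> = \<lambda>\<close>. In the norm \<open>sup |v(\<xi>)| / |\<xi>|\<^sup>2\<close> its solution operator is
  bounded by \<open>1/|w|\<close>, respectively \<open>1/|Re \<lambda>|\<close>, on discs of any radius, while Cauchy's estimate
  makes the nonlinear terms Lipschitz with arbitrarily small constant near 0; so \<open>P\<close> is the fixed
  point of a contraction.

  For uniqueness, if two invariant graphs differ first at order \<open>m \<ge> 2\<close>, the invariance equations
  multiply the leading coefficients of the difference by \<open>i w (m - 1)\<close> and \<open>i w m - \<lambda>\<close>, neither of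
  which vanishes, and give 0.\<close>

section \<open>Holomorphic functions of three variables\<close>

text \<open>For a graph \<open>y = \<phi> x\<close> the invariance equation multiplies the unknown
  derivative of \<open>\<phi>\<close> by a coefficient that itself contains the unknowns, so
  iterating it would cost a derivative. For the parametrization the derivative occurs only in the
  linear operator \<open>i w \<xi> v' - \<mu> v\<close>, which is inverted exactly, and the
  nonlinear terms contain no derivative. On \<open>\<xi> ^ n\<close> the operator is multiplication
  by \<open>i w n - \<mu>\<close>. There are no small divisors, and the only one that vanishes is
  \<open>n = 1\<close> for \<open>\<mu> = i w\<close>. The weight \<open>|\<xi>|\<close> squared
  excludes that degree, which also removes the freedom to rescale \<open>\<xi>\<close>.

  The remaining obstacle is the Jordan block: \<open>y\<close> enters the first equation with
  coefficient 1, which does not become small near 0. The linear part is triangular, however. Solving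
  for the new \<open>Y\<close> first and inserting it into the equation for \<open>X\<close> puts
  the small Lipschitz constant in front of every difference.\<close>

lemma holo3_on_chain:
  assumes "holo3_on f U" "(a x, b x, c x) \<in> U"
    and "(a has_field_derivative a') (at x)" "(b has_field_derivative b') (at x)"
        "(c has_field_derivative c') (at x)"
  shows "\<exists>D. (f has_derivative D) (at (a x, b x, c x)) \<and>
      ((\<lambda>x. f (a x, b x, c x)) has_field_derivative D (a', b', c')) (at x)"
proof -
  obtain D where D: "(f has_derivative D) (at (a x, b x, c x))"
    and lin: "\<And>c a b d. D (c * a, c * b, c * d) = c * D (a, b, d)"
    using assms(1,2) unfolding holo3_on_def by blast
  have "((\<lambda>x. (a x, b x, c x)) has_derivative (\<lambda>t. (t * a', t * b', t * c'))) (at x)"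
    using assms(3-5) by (intro has_derivative_Pair) (simp_all add: has_field_derivative_def mult_commute_abs)
  then have "((\<lambda>x. f (a x, b x, c x)) has_derivative (\<lambda>t. D (t * a', t * b', t * c'))) (at x)"
    using D by (rule has_derivative_compose)
  \<comment> \<open>Complex homogeneity of \<open>D\<close> turns the real derivative along the
    curve into multiplication by one complex number.\<close>
  then have "((\<lambda>x. f (a x, b x, c x)) has_field_derivative D (a', b', c')) (at x)"
    unfolding has_field_derivative_def lin by (simp add: mult_commute_abs)
  with D show ?thesis by blast
qed

lemma holo3_on_compose:
  assumes "holo3_on f U" "open S" "a holomorphic_on S" "b holomorphic_on S" "c holomorphic_on S"
    and "\<And>x. x \<in> S \<Longrightarrow> (a x, b x, c x) \<in> U"
  shows "(\<lambda>x. f (a x, b x, c x)) holomorphic_on S"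
  unfolding holomorphic_on_open[OF assms(2)]
proof
  fix x assume "x \<in> S"
  then show "\<exists>d. ((\<lambda>x. f (a x, b x, c x)) has_field_derivative d) (at x)"
    using holo3_on_chain[OF assms(1), of a x b c] assms(2-6) by (meson holomorphic_derivI)
qed

lemma norm_triple_scale: "norm ((t * a, t * b, t * d) :: c3) = norm t * norm (a, b, d)"
proof -
  have "(cmod t * cmod a)\<^sup>2 + ((cmod t * cmod b)\<^sup>2 + (cmod t * cmod d)\<^sup>2) =
     (cmod t)\<^sup>2 * ((cmod a)\<^sup>2 + ((cmod b)\<^sup>2 + (cmod d)\<^sup>2))"
    by (simp add: algebra_simps power_mult_distrib)
  then show ?thesis by (simp add: norm_Pair norm_mult real_sqrt_mult)
qed

text \<open>Cauchy's estimate on complex lines: for \<open>q\<close> within \<open>\<delta>\<close>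
  of \<open>p\<close>, the points \<open>q + t v\<close> with \<open>|t| |v| < 2 \<delta>\<close>
  stay in the ball of radius \<open>3 * \<delta>\<close>. Hence the derivative in direction
  \<open>v\<close> is at most \<open>M / R\<close> with \<open>R = \<delta> / |v|\<close>, and the
  mean value inequality on the convex ball of radius \<open>\<delta>\<close> finishes.\<close>

lemma holo3_on_lipschitz:
  fixes p :: c3
  assumes f: "holo3_on f (ball p (3 * \<delta>))" and "\<delta> > 0"
    and M: "\<And>q. q \<in> ball p (3 * \<delta>) \<Longrightarrow> norm (f q) \<le> M"
    and "q \<in> ball p \<delta>" "q' \<in> ball p \<delta>"
  shows "norm (f q - f q') \<le> M / \<delta> * norm (q - q')"
proof -
  have der: "\<exists>D. (f has_derivative D) (at q) \<and> onorm D \<le> M / \<delta>" if q: "q \<in> ball p \<delta>" for q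
  proof -
    obtain x y z where qe: "q = (x, y, z)" by (cases q)
    have "q \<in> ball p (3 * \<delta>)" using q \<open>\<delta> > 0\<close> by auto
    then obtain D where D: "(f has_derivative D) (at q)" using f unfolding holo3_on_def by blast
    interpret D: bounded_linear D using D by (rule has_derivative_bounded_linear)
    have M0: "M \<ge> 0" using M[of q] \<open>q \<in> ball p (3 * \<delta>)\<close> norm_ge_zero order_trans by blast
    have "norm (D v) \<le> M / \<delta> * norm v" for v
    proof (cases "v = 0")
      case True then show ?thesis using D.zero by simp
    next
      case False
      obtain a b d where v: "v = (a, b, d)" by (cases v)
      define R where "R = \<delta> / norm v"
      have R: "R > 0" "R * norm v = \<delta>" using False \<open>\<delta> > 0\<close> by (auto simp: R_def)
      have inU: "(x + t * a, y + t * b, z + t * d) \<in> ball p (3 * \<delta>)" if "t \<in> ball 0 (2 * R)" for t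
      proof -
        have "dist p (x + t * a, y + t * b, z + t * d) \<le> dist p q + dist q (q + (t * a, t * b, t * d))"
          unfolding qe by (metis add_Pair dist_triangle)
        also have "dist q (q + (t * a, t * b, t * d)) = norm t * norm v"
          by (metis add_diff_cancel_left' dist_commute dist_norm norm_triple_scale v)
        also have "norm t * norm v \<le> 2 * R * norm v"
          using that by (intro mult_right_mono) auto
        finally show ?thesis using q R by auto
      qed
      let ?g = "\<lambda>t. f (x + t * a, y + t * b, z + t * d)"
      have hol: "?g holomorphic_on ball 0 (2 * R)"
        by (intro holo3_on_compose[OF f]) (use inU in \<open>auto intro!: holomorphic_intros\<close>)
      have sub: "cball 0 R \<subseteq> ball 0 (2 * R)" using R by auto
      have ds: "((\<lambda>t. x + t * a) has_field_derivative a) (at 0)"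
        "((\<lambda>t. y + t * b) has_field_derivative b) (at 0)"
        "((\<lambda>t. z + t * d) has_field_derivative d) (at 0)"
        by (auto intro!: derivative_eq_intros)
      obtain D' where D': "(f has_derivative D') (at (x + 0 * a, y + 0 * b, z + 0 * d))"
        and g': "(?g has_field_derivative D' (a, b, d)) (at 0)"
        using holo3_on_chain[OF f, of "\<lambda>t. x + t * a" 0 "\<lambda>t. y + t * b" "\<lambda>t. z + t * d" a b d]
          inU[of 0] R ds by auto
      have "D' = D" using D' D by (auto simp: qe intro: has_derivative_unique)
      have "norm ((deriv ^^ 1) ?g 0) \<le> fact 1 * M / R ^ 1"
      proof (rule Cauchy_inequality)
        show "?g holomorphic_on ball 0 R" using hol sub by (meson ball_subset_cball holomorphic_on_subset order_trans)
        show "continuous_on (cball 0 R) ?g" using hol sub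
          by (meson holomorphic_on_imp_continuous_on continuous_on_subset)
        show "norm (?g t) \<le> M" if "norm (0 - t) = R" for t
          using that by (intro M inU) (use R in auto)
      qed (use R in auto)
      then have "norm (D v) \<le> M / R" using DERIV_imp_deriv[OF g'] \<open>D' = D\<close> by (simp add: v)
      then show ?thesis by (simp add: R_def)
    qed
    then have "onorm D \<le> M / \<delta>"
      using M0 \<open>\<delta> > 0\<close> by (intro onorm_bound) auto
    with D show ?thesis by blast
  qed
  then obtain D where D: "\<And>q. q \<in> ball p \<delta> \<Longrightarrow> (f has_derivative D q) (at q) \<and> onorm (D q) \<le> M / \<delta>"
    by metis
  show ?thesis
    by (rule differentiable_bound[where S = "ball p \<delta>" and f' = D])
       (use D assms in \<open>auto intro: has_derivative_at_withinI\<close>)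
qed

text \<open>A zero derivative at 0 gives \<open>|f p| \<le> e / 3 * |p|\<close> near 0, hence the
  bound \<open>e * \<delta>\<close> on the ball of radius \<open>3 * \<delta>\<close>. Cauchy's
  estimate divides this by \<open>\<delta>\<close> and leaves the constant \<open>e\<close>.\<close>

lemma vanish2_lipschitz:
  assumes "holo3_on f U" "open U" "0 \<in> U" "vanish2 f" "e > 0"
  shows "\<exists>\<delta>>0. ball 0 \<delta> \<subseteq> U \<and> (\<forall>p\<in>ball 0 \<delta>. \<forall>q\<in>ball 0 \<delta>. norm (f p - f q) \<le> e * norm (p - q))"
proof -
  obtain d0 where d0: "d0 > 0" "ball 0 d0 \<subseteq> U" using assms(2,3) open_contains_ball by blast
  have "(f has_derivative (\<lambda>_. 0)) (at 0)" "f 0 = 0" using assms(4) by (auto simp: vanish2_def)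
  then obtain d1 where d1: "d1 > 0" "\<And>p. norm p < d1 \<Longrightarrow> norm (f p) \<le> e / 3 * norm p"
    using \<open>e > 0\<close> unfolding has_derivative_at_alt
    by (metis (no_types, opaque_lifting) diff_zero divide_pos_pos zero_less_numeral)
  define \<delta> where "\<delta> = min d0 d1 / 3"
  have \<delta>: "\<delta> > 0" "3 * \<delta> \<le> d0" "3 * \<delta> \<le> d1" using d0 d1 by (auto simp: \<delta>_def)
  have h: "holo3_on f (ball 0 (3 * \<delta>))"
    using assms(1) d0 \<delta> unfolding holo3_on_def by (meson subset_ball subset_iff)
  have M: "norm (f q) \<le> e * \<delta>" if "q \<in> ball 0 (3 * \<delta>)" for q
  proof -
    have "norm (f q) \<le> e / 3 * norm q" using d1(2)[of q] that \<delta> by auto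
    also have "\<dots> \<le> e / 3 * (3 * \<delta>)" using that \<open>e > 0\<close> by (intro mult_left_mono) auto
    finally show ?thesis by simp
  qed
  have "norm (f p - f q) \<le> e * norm (p - q)" if "p \<in> ball 0 \<delta>" "q \<in> ball 0 \<delta>" for p q
    using holo3_on_lipschitz[OF h \<delta>(1) M that] \<delta>(1) by simp
  moreover have "ball 0 \<delta> \<subseteq> U" using d0 \<delta> by (meson order_trans subset_ball less_imp_le linorder_not_le mult_le_cancel_right1 order.trans one_le_numeral)
  ultimately show ?thesis using \<delta>(1) by blast
qed

section \<open>The equation \<open>i w x v' - \<mu> v = u\<close> on a disc\<close>

lemma holomorphic_on_ball_tendsto_0:
  assumes "a holomorphic_on ball 0 r" "r > 0"
  shows "a \<midarrow>0\<rightarrow> a 0"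
proof -
  have "isCont a 0" using assms
    by (metis holomorphic_on_imp_continuous_on centre_in_ball continuous_on_eq_continuous_at open_ball)
  then show ?thesis by (simp add: isCont_def)
qed

lemma holomorphic_on_ball_factor:
  assumes "a holomorphic_on ball 0 r" "a 0 = 0" "r > 0"
  obtains b where "b holomorphic_on ball 0 r" "\<And>x. x \<in> ball 0 r \<Longrightarrow> a x = x * b x" "b 0 = deriv a 0"
proof
  show "(\<lambda>z. if z = 0 then deriv a 0 else (a z - a 0) / (z - 0)) holomorphic_on ball 0 r"
    by (rule pole_lemma) (use assms in auto)
qed (use assms in auto)

text \<open>Finiteness of the weighted norm on the open disc. A double zero at 0 alone would not do,
  since \<open>u\<close> could be unbounded towards the boundary circle.\<close>

definition quadratic_on :: "real \<Rightarrow> (complex \<Rightarrow> complex) \<Rightarrow> bool" where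
  "quadratic_on r u \<longleftrightarrow> u holomorphic_on ball 0 r \<and>
     (\<exists>M. \<forall>x\<in>ball 0 r. norm (u x) \<le> M * (norm x)\<^sup>2)"

lemma quadratic_onI:
  assumes "u holomorphic_on ball 0 r" "\<And>x. x \<in> ball 0 r \<Longrightarrow> norm (u x) \<le> M * (norm x)\<^sup>2"
  shows "quadratic_on r u"
  using assms unfolding quadratic_on_def by blast

lemma quadratic_on_add:
  assumes "quadratic_on r u" "quadratic_on r v"
  shows "quadratic_on r (\<lambda>x. u x + v x)"
proof -
  obtain M N where "\<And>x. x \<in> ball 0 r \<Longrightarrow> norm (u x) \<le> M * (norm x)\<^sup>2"
    "\<And>x. x \<in> ball 0 r \<Longrightarrow> norm (v x) \<le> N * (norm x)\<^sup>2"
    using assms unfolding quadratic_on_def by blast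
  then have "norm (u x + v x) \<le> (M + N) * (norm x)\<^sup>2" if "x \<in> ball 0 r" for x
    using that by (metis norm_add_rule_thm ring_class.ring_distribs(2))
  then show ?thesis
    using assms by (intro quadratic_onI[of _ _ "M + N"]) (auto simp: quadratic_on_def intro: holomorphic_on_add)
qed

lemma quadratic_on_at_0:
  assumes "quadratic_on r u" "r > 0"
  shows "u 0 = 0" "deriv u 0 = 0"
proof -
  obtain M where M: "\<And>x. x \<in> ball 0 r \<Longrightarrow> norm (u x) \<le> M * (norm x)\<^sup>2"
    using assms unfolding quadratic_on_def by blast
  show u0: "u 0 = 0" using M[of 0] \<open>r > 0\<close> by simp
  obtain b where b: "b holomorphic_on ball 0 r" "\<And>x. x \<in> ball 0 r \<Longrightarrow> u x = x * b x" "b 0 = deriv u 0"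
    using holomorphic_on_ball_factor assms u0 unfolding quadratic_on_def by metis
  have lim: "(\<lambda>x. norm (b x)) \<midarrow>0\<rightarrow> norm (b 0)"
    using holomorphic_on_ball_tendsto_0[OF b(1) \<open>r > 0\<close>] by (rule tendsto_norm)
  have "norm (b x) \<le> M * norm x" if "x \<in> ball 0 r" "x \<noteq> 0" for x
    using M[OF that(1)] b(2)[OF that(1)] that(2) by (simp add: norm_mult power2_eq_square)
  then have "\<forall>\<^sub>F x in at 0. norm (b x) \<le> M * norm x"
    using \<open>r > 0\<close> by (auto simp: eventually_at intro!: exI[of _ r])
  moreover have "(\<lambda>x::complex. M * norm x) \<midarrow>0\<rightarrow> M * norm (0::complex)"
    by (intro tendsto_mult tendsto_const tendsto_norm tendsto_ident_at)
  ultimately have "norm (b 0) \<le> 0"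
    using tendsto_le[OF _ _ lim, of "\<lambda>x. M * norm x" "M * norm (0::complex)"] by simp
  then show "deriv u 0 = 0" using b(3) by simp
qed

text \<open>A double zero becomes a weighted bound on a smaller disc: after dividing by
  \<open>x\<close> twice, the quotient is bounded on the compact disc of radius
  \<open>s\<close>.\<close>

lemma quadratic_on_subball:
  assumes u: "u holomorphic_on ball 0 r" "u 0 = 0" "deriv u 0 = 0" and "s < r" "s > 0"
  obtains M where "M \<ge> 0" "\<And>x. x \<in> ball 0 s \<Longrightarrow> norm (u x) \<le> M * (norm x)\<^sup>2"
proof -
  have "r > 0" using assms by simp
  obtain b where b: "b holomorphic_on ball 0 r" "\<And>x. x \<in> ball 0 r \<Longrightarrow> u x = x * b x" "b 0 = deriv u 0"
    using holomorphic_on_ball_factor u \<open>r > 0\<close> by metis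
  obtain c where c: "c holomorphic_on ball 0 r" "\<And>x. x \<in> ball 0 r \<Longrightarrow> b x = x * c x"
    using holomorphic_on_ball_factor[of b r] b u \<open>r > 0\<close> by metis
  have "compact (c ` cball 0 s)"
    using c(1) \<open>s < r\<close> 
    by (intro compact_continuous_image) (auto intro!: holomorphic_on_imp_continuous_on elim: holomorphic_on_subset)
  then obtain M where M: "\<And>x. x \<in> cball 0 s \<Longrightarrow> norm (c x) \<le> M"
    by (meson bounded_iff compact_imp_bounded imageI)
  have "norm (u x) \<le> M * (norm x)\<^sup>2" if "x \<in> ball 0 s" for x
  proof -
    have "norm (u x) = norm (c x) * (norm x)\<^sup>2"
      using b(2)[of x] c(2)[of x] that \<open>s < r\<close> by (simp add: norm_mult power2_eq_square)
    then show ?thesis using M[of x] that by (simp add: mult_right_mono)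
  qed
  moreover have "M \<ge> 0" using M[of 0] \<open>s > 0\<close> norm_ge_zero[of "c 0"] by (simp del: norm_ge_zero)
  ultimately show thesis using that by blast
qed

text \<open>The equation \<open>i w x v' - \<mu> v = u\<close> is solved by dividing the Taylor coefficients of \<open>u\<close>
  by \<open>i w n - \<mu>\<close>.\<close>
lemma euler_equation_solvable:
  assumes "quadratic_on r u" "r > 0" "c > 0"
    and c: "\<And>n. n \<ge> 2 \<Longrightarrow> c \<le> norm (\<i> * of_real w * of_nat n - \<mu>)"
  obtains v where "v holomorphic_on ball 0 r" "v 0 = 0" "deriv v 0 = 0"
    "\<And>x. x \<in> ball 0 r \<Longrightarrow> \<i> * of_real w * x * deriv v x - \<mu> * v x = u x"
proof -
  define U where "U n = (deriv ^^ n) u 0 / fact n" for n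
  \<comment> \<open>In degrees 0 and 1 the divisor may vanish (\<open>n = 1\<close>,
    \<open>\<mu> = i w\<close>), but \<open>U\<close> vanishes there too. The value 0 therefore
    solves the equation and gives \<open>v\<close> a double zero.\<close>
  define V where "V n = (if n < 2 then 0 else U n / (\<i> * of_real w * of_nat n - \<mu>))" for n
  have U01: "U n = 0" if "n < 2" for n
    using that quadratic_on_at_0[OF assms(1,2)] unfolding U_def by (auto simp: less_2_cases_iff)
  have sumsU: "(\<lambda>n. U n * x ^ n) sums u x" if "norm x < r" for x
    using holomorphic_power_series[of u 0 r x] assms(1) that by (auto simp: U_def quadratic_on_def)
  have normV: "norm (V n) \<le> norm (U n) / c" for n
    using c[of n] \<open>c > 0\<close> by (auto simp: V_def norm_divide intro!: divide_left_mono mult_pos_pos intro: less_le_trans simp del: zero_less_norm_iff)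
  have summV: "summable (\<lambda>n. V n * x ^ n)" if x: "norm x < r" for x
  proof -
    \<comment> \<open>Convergence of the series of \<open>U\<close> at the larger radius
      \<open>t\<close> makes it absolutely convergent at \<open>x\<close>, so it can dominate the
      series of \<open>V\<close>.\<close>
    obtain t where t: "norm x < t" "t < r" using dense[OF x] by blast
    moreover have "\<bar>t\<bar> < r" using t norm_ge_zero[of x] by linarith
    ultimately have "summable (\<lambda>n. norm (U n * x ^ n))"
      using sumsU[of "of_real t"] by (intro powser_insidea[of U "of_real t"]) (auto simp: sums_iff)
    then have "summable (\<lambda>n. norm (U n * x ^ n) / c)" by (rule summable_divide)
    then show ?thesis
    proof (rule summable_comparison_test[rotated], intro exI allI impI)
      show "norm (V n * x ^ n) \<le> norm (U n * x ^ n) / c" for n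
        using mult_right_mono[OF normV[of n], of "norm (x ^ n)"] by (simp add: norm_mult)
    qed
  qed
  define v where "v x = (\<Sum>n. V n * x ^ n)" for x
  have dv: "(v has_field_derivative (\<Sum>n. diffs V n * x ^ n)) (at x)" if "norm x < r" for x
    using termdiffs_strong'[of r V x] summV that unfolding v_def by blast
  show thesis
  proof
    show "v holomorphic_on ball 0 r"
      unfolding holomorphic_on_open[OF open_ball] using dv by (metis mem_ball_0)
    show "v 0 = 0" by (simp add: v_def V_def)
    show "deriv v 0 = 0" using DERIV_imp_deriv[OF dv[of 0]] \<open>r > 0\<close> by (simp add: diffs_def V_def)
    fix x :: complex assume "x \<in> ball 0 r"
    then have x: "norm x < r" by simp
    have "summable (\<lambda>n. diffs V n * x ^ n)"
      using termdiff_converges[of x r V] summV x by blast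
    then have "(\<lambda>n. of_nat n * V n * x ^ (n - Suc 0)) sums deriv v x"
      using diffs_equiv DERIV_imp_deriv[OF dv[OF x]] by metis
    then have "(\<lambda>n. \<i> * of_real w * x * (of_nat n * V n * x ^ (n - Suc 0)) - \<mu> * (V n * x ^ n)) sums
       (\<i> * of_real w * x * deriv v x - \<mu> * v x)"
      using summable_sums[OF summV[OF x]] unfolding v_def by (intro sums_diff sums_mult)
    moreover have "\<i> * of_real w * x * (of_nat n * V n * x ^ (n - Suc 0)) - \<mu> * (V n * x ^ n) = U n * x ^ n" for n
    proof (cases "n < 2")
      case True then show ?thesis by (simp add: V_def U01)
    next
      case False
      then have "\<i> * of_real w * of_nat n - \<mu> \<noteq> 0" using c[of n] \<open>c > 0\<close> by auto
      then have e: "(\<i> * of_real w * of_nat n - \<mu>) * V n = U n" using False by (simp add: V_def)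
      have "x * x ^ (n - Suc 0) = x ^ n" using False by (cases n) auto
      then have "\<i> * of_real w * x * (of_nat n * V n * x ^ (n - Suc 0)) - \<mu> * (V n * x ^ n)
         = (\<i> * of_real w * of_nat n - \<mu>) * V n * x ^ n"
        by (simp add: algebra_simps)
      then show ?thesis by (simp add: e)
    qed
    ultimately show "\<i> * of_real w * x * deriv v x - \<mu> * v x = u x"
      using sumsU[OF x] sums_unique2 by simp
  qed
qed

text \<open>Where \<open>|v|\<close> is maximal on a circle, the derivative \<open>i w x v' = \<mu> v + u\<close> of \<open>v\<close> along the
  circle is orthogonal to \<open>v\<close>.\<close>
lemma euler_equation_bound_hyperbolic:
  fixes w :: real and \<mu> :: complex
  assumes v: "v holomorphic_on ball 0 r" and "Re \<mu> \<noteq> 0"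
    and eq: "\<And>x. x \<in> ball 0 r \<Longrightarrow> \<i> * of_real w * x * deriv v x - \<mu> * v x = u x"
    and M: "\<And>x. x \<in> ball 0 r \<Longrightarrow> norm (u x) \<le> M * (norm x)\<^sup>2"
    and x: "x \<in> ball 0 r"
  shows "norm (v x) \<le> M / \<bar>Re \<mu>\<bar> * (norm x)\<^sup>2"
proof -
  let ?S = "sphere (0::complex) (norm x)"
  have sub: "?S \<subseteq> ball 0 r" using x by auto
  have "continuous_on ?S (\<lambda>x. norm (v x))"
    using v sub by (intro continuous_on_norm holomorphic_on_imp_continuous_on) (rule holomorphic_on_subset)
  then obtain y where y: "norm y = norm x" and ymax: "\<And>z. norm z = norm x \<Longrightarrow> norm (v z) \<le> norm (v y)"
    using continuous_attains_sup[of ?S "\<lambda>x. norm (v x)"] by fastforce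
  have yr: "y \<in> ball 0 r" using y x by simp
  have d1: "((\<lambda>z. v (exp (\<i> * of_real w * z) * y)) has_field_derivative
      deriv v (exp (\<i> * of_real w * 0) * y) * (\<i> * of_real w * y)) (at 0)"
    by (rule DERIV_chain2[where f = v, OF holomorphic_derivI[OF v open_ball]])
       (use yr in \<open>auto intro!: derivative_eq_intros\<close>)
  then have "((\<lambda>t. v (exp (\<i> * of_real w * of_real t) * y)) has_vector_derivative
      (\<i> * of_real w * y * deriv v y)) (at 0)"
    using has_vector_derivative_real_field[of "\<lambda>z. v (exp (\<i> * of_real w * z) * y)" _ 0]
    by (simp add: mult.commute)
  then have d2: "((\<lambda>t. v (exp (\<i> * of_real w * of_real t) * y)) has_vector_derivative (\<mu> * v y + u y)) (at 0)"
    using eq[OF yr] by (metis add.commute diff_add_cancel)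
  have "((\<lambda>t. inner (v (exp (\<i> * of_real w * of_real t) * y)) (v (exp (\<i> * of_real w * of_real t) * y)))
      has_real_derivative (2 * inner (v y) (\<mu> * v y + u y))) (at 0)"
    unfolding has_real_derivative_iff_has_vector_derivative has_vector_derivative_def
    by (rule has_derivative_eq_rhs[OF has_derivative_inner[OF d2[unfolded has_vector_derivative_def] d2[unfolded has_vector_derivative_def]]])
       (auto simp: inner_commute algebra_simps)
  then have "2 * inner (v y) (\<mu> * v y + u y) = 0"
  proof (rule DERIV_local_max[OF _ zero_less_one], intro allI impI)
    fix t :: real
    have "norm (v (exp (\<i> * of_real w * of_real t) * y)) \<le> norm (v y)"
      by (intro ymax) (simp add: norm_mult y)
    then show "inner (v (exp (\<i> * of_real w * of_real t) * y)) (v (exp (\<i> * of_real w * of_real t) * y)) \<le>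
       inner (v (exp (\<i> * of_real w * of_real 0) * y)) (v (exp (\<i> * of_real w * of_real 0) * y))"
      by (simp add: dot_square_norm power_mono)
  qed
  \<comment> \<open>The imaginary part of \<open>\<mu>\<close> turns \<open>v y\<close> by a right
    angle, so only \<open>Re \<mu>\<close> survives in the inner product.\<close>
  moreover have "inner (v y) (\<mu> * v y) = Re \<mu> * (norm (v y))\<^sup>2"
    unfolding inner_complex_def cmod_power2 by (simp add: algebra_simps power2_eq_square)
  ultimately have "Re \<mu> * (norm (v y))\<^sup>2 = - inner (v y) (u y)" by (simp add: inner_add_right)
  then have "\<bar>Re \<mu>\<bar> * (norm (v y))\<^sup>2 \<le> norm (v y) * norm (u y)"
    by (metis Cauchy_Schwarz_ineq2 abs_minus_cancel abs_mult abs_power2)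
  then have "\<bar>Re \<mu>\<bar> * norm (v y) \<le> norm (u y)"
    by (cases "v y = 0") (auto simp: power2_eq_square)
  then have "norm (v y) \<le> norm (u y) / \<bar>Re \<mu>\<bar>" using \<open>Re \<mu> \<noteq> 0\<close> by (simp add: field_simps)
  also have "\<dots> \<le> M * (norm x)\<^sup>2 / \<bar>Re \<mu>\<bar>" using M[OF yr] y by (intro divide_right_mono) auto
  finally show ?thesis using ymax[of x] by simp
qed

text \<open>The maximum argument on circles gives nothing here because the eigenvalue is purely
  imaginary. Instead \<open>v = x * a\<close> with \<open>a 0 = 0\<close> cancels the term without
  derivative and leaves \<open>i w x^2 a' = u\<close>. So \<open>a'\<close> is bounded by
  \<open>M / |w|\<close>, and integrating from 0 restores the second factor
  \<open>|x|\<close>.\<close>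

lemma euler_equation_bound_resonant:
  fixes w :: real
  assumes v: "v holomorphic_on ball 0 r" "v 0 = 0" "deriv v 0 = 0" and "w \<noteq> 0"
    and eq: "\<And>x. x \<in> ball 0 r \<Longrightarrow> \<i> * of_real w * x * deriv v x - \<i> * of_real w * v x = u x"
    and M: "\<And>x. x \<in> ball 0 r \<Longrightarrow> norm (u x) \<le> M * (norm x)\<^sup>2"
    and x: "x \<in> ball 0 r"
  shows "norm (v x) \<le> M / \<bar>w\<bar> * (norm x)\<^sup>2"
proof -
  have "r > 0" using x by (auto intro: le_less_trans[OF norm_ge_zero])
  obtain a where a: "a holomorphic_on ball 0 r" "\<And>x. x \<in> ball 0 r \<Longrightarrow> v x = x * a x" "a 0 = 0"
    using holomorphic_on_ball_factor v \<open>r > 0\<close> by metis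
  have da: "norm (deriv a z) \<le> M / \<bar>w\<bar>" if z: "z \<in> ball 0 r" "z \<noteq> 0" for z
  proof -
    have "((\<lambda>x. x * a x) has_field_derivative (z * deriv a z + a z)) (at z)"
      using holomorphic_derivI[OF a(1) open_ball z(1)] by (auto intro!: derivative_eq_intros)
    moreover have "\<forall>\<^sub>F x in nhds z. v x = x * a x"
      using eventually_nhds_in_open[OF open_ball z(1)] by (rule eventually_mono) (rule a(2))
    ultimately have "(v has_field_derivative (z * deriv a z + a z)) (at z)"
      by (subst DERIV_cong_ev[OF refl _ refl])
    then have "deriv v z = z * deriv a z + a z" by (rule DERIV_imp_deriv)
    then have "u z = \<i> * of_real w * z\<^sup>2 * deriv a z"
      using eq[OF z(1)] a(2)[OF z(1)] by (simp add: algebra_simps power2_eq_square)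
    then have "\<bar>w\<bar> * norm (deriv a z) * (norm z)\<^sup>2 \<le> M * (norm z)\<^sup>2"
      using M[OF z(1)] by (simp add: norm_mult norm_power mult.commute mult.left_commute)
    then show ?thesis using z(2) \<open>w \<noteq> 0\<close> by (simp add: field_simps)
  qed
  have da0: "norm (deriv a z) \<le> M / \<bar>w\<bar>" if z: "z \<in> ball 0 r" for z
  proof (cases "z = 0")
    case True
    \<comment> \<open>Dividing by the square of \<open>z\<close> excluded the origin; continuity of
      \<open>a'\<close> carries the bound there.\<close>
    have lim: "(\<lambda>x. norm (deriv a x)) \<midarrow>0\<rightarrow> norm (deriv a 0)"
      using holomorphic_on_ball_tendsto_0[OF holomorphic_deriv[OF a(1) open_ball] \<open>r > 0\<close>] by (rule tendsto_norm)
    have "\<forall>\<^sub>F x in at 0. norm (deriv a x) \<le> M / \<bar>w\<bar>"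
      using \<open>r > 0\<close> da by (auto simp: eventually_at intro!: exI[of _ r])
    with lim show ?thesis unfolding True by (rule tendsto_upperbound) simp
  qed (use da that in auto)
  have "norm (a x - a 0) \<le> M / \<bar>w\<bar> * norm (x - 0)"
    by (rule field_differentiable_bound[of "ball 0 r" a "deriv a"])
       (use da0 x \<open>r > 0\<close> has_field_derivative_at_within[OF holomorphic_derivI[OF a(1) open_ball]] in auto)
  then have "norm (a x) * norm x \<le> M / \<bar>w\<bar> * norm x * norm x"
    using a(3) by (intro mult_right_mono) auto
  then show ?thesis using a(2)[OF x] by (simp add: norm_mult power2_eq_square ac_simps)
qed

text \<open>The a priori bound is a hypothesis so that the resonant and the hyperbolic equation
  share this construction. The operator \<open>S\<close> is obtained by choice and not shown to be
  linear; the last property replaces linearity, by applying the bound to \<open>S u - S u'\<close>,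
  which solves the equation with right side \<open>u - u'\<close>.\<close>

lemma euler_equation_solver:
  fixes w :: real
  assumes "r > 0" "c > 0"
    and c: "\<And>n. n \<ge> 2 \<Longrightarrow> c \<le> norm (\<i> * of_real w * of_nat n - \<mu>)"
    and bound: "\<And>u v M x. \<lbrakk>v holomorphic_on ball 0 r; v 0 = 0; deriv v 0 = 0;
       \<And>x. x \<in> ball 0 r \<Longrightarrow> \<i> * of_real w * x * deriv v x - \<mu> * v x = u x;
       \<And>x. x \<in> ball 0 r \<Longrightarrow> norm (u x) \<le> M * (norm x)\<^sup>2; x \<in> ball 0 r\<rbrakk>
       \<Longrightarrow> norm (v x) \<le> M / B * (norm x)\<^sup>2"
  obtains S where "\<And>u. quadratic_on r u \<Longrightarrow> quadratic_on r (S u)"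
    and "\<And>u x. \<lbrakk>quadratic_on r u; x \<in> ball 0 r\<rbrakk> \<Longrightarrow>
           \<i> * of_real w * x * deriv (S u) x - \<mu> * S u x = u x"
    and "\<And>u M x. \<lbrakk>quadratic_on r u; \<And>x. x \<in> ball 0 r \<Longrightarrow> norm (u x) \<le> M * (norm x)\<^sup>2; x \<in> ball 0 r\<rbrakk>
           \<Longrightarrow> norm (S u x) \<le> M / B * (norm x)\<^sup>2"
    and "\<And>u u' M x. \<lbrakk>quadratic_on r u; quadratic_on r u';
           \<And>x. x \<in> ball 0 r \<Longrightarrow> norm (u x - u' x) \<le> M * (norm x)\<^sup>2; x \<in> ball 0 r\<rbrakk>
           \<Longrightarrow> norm (S u x - S u' x) \<le> M / B * (norm x)\<^sup>2"
proof -
  have "\<exists>v. quadratic_on r u \<longrightarrow> v holomorphic_on ball 0 r \<and> v 0 = 0 \<and> deriv v 0 = 0 \<and>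
      (\<forall>x\<in>ball 0 r. \<i> * of_real w * x * deriv v x - \<mu> * v x = u x)" for u
    using euler_equation_solvable[OF _ \<open>r > 0\<close> \<open>c > 0\<close> c, of u] by metis
  then obtain S where S: "\<And>u. quadratic_on r u \<Longrightarrow> S u holomorphic_on ball 0 r \<and> S u 0 = 0 \<and> deriv (S u) 0 = 0 \<and>
      (\<forall>x\<in>ball 0 r. \<i> * of_real w * x * deriv (S u) x - \<mu> * S u x = u x)"
    by metis
  have Sb: "norm (S u x) \<le> M / B * (norm x)\<^sup>2"
    if "quadratic_on r u" "\<And>x. x \<in> ball 0 r \<Longrightarrow> norm (u x) \<le> M * (norm x)\<^sup>2" "x \<in> ball 0 r" for u M x
    using bound[of "S u" u M x] S[OF that(1)] that by blast
  show thesis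
  proof
    show "quadratic_on r (S u)" if u: "quadratic_on r u" for u
    proof -
      obtain M where "\<And>x. x \<in> ball 0 r \<Longrightarrow> norm (u x) \<le> M * (norm x)\<^sup>2"
        using u unfolding quadratic_on_def by blast
      with Sb[OF u this] S[OF u] show ?thesis by (intro quadratic_onI[of _ _ "M / B"]) auto
    qed
    show "\<i> * of_real w * x * deriv (S u) x - \<mu> * S u x = u x" if "quadratic_on r u" "x \<in> ball 0 r" for u x
      using S that by blast
    fix u u' M and x :: complex
    assume u: "quadratic_on r u" "quadratic_on r u'" 
      and M: "\<And>x. x \<in> ball 0 r \<Longrightarrow> norm (u x - u' x) \<le> M * (norm x)\<^sup>2" and x: "x \<in> ball 0 r"
    have d: "((\<lambda>x. S u x - S u' x) has_field_derivative (deriv (S u) x - deriv (S u') x)) (at x)" if "x \<in> ball 0 r" for x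
      using S[OF u(1)] S[OF u(2)] that by (auto intro!: derivative_intros holomorphic_derivI)
    show "norm (S u x - S u' x) \<le> M / B * (norm x)\<^sup>2"
    proof (rule bound[of "\<lambda>x. S u x - S u' x" "\<lambda>x. u x - u' x" M])
      show "(\<lambda>x. S u x - S u' x) holomorphic_on ball 0 r"
        using S[OF u(1)] S[OF u(2)] by (intro holomorphic_on_diff) auto
      show "deriv (\<lambda>x. S u x - S u' x) 0 = 0"
        using DERIV_imp_deriv[OF d[of 0]] S[OF u(1)] S[OF u(2)] \<open>r > 0\<close> by simp
      show "\<i> * of_real w * x * deriv (\<lambda>x. S u x - S u' x) x - \<mu> * (S u x - S u' x) = u x - u' x"
        if x: "x \<in> ball 0 r" for x
      proof -
        have "\<i> * of_real w * x * deriv (S u) x - \<mu> * S u x = u x"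
          "\<i> * of_real w * x * deriv (S u') x - \<mu> * S u' x = u' x"
          using S[OF u(1)] S[OF u(2)] x by auto
        then show ?thesis unfolding DERIV_imp_deriv[OF d[OF x]] by (simp add: algebra_simps)
      qed
    qed (use S[OF u(1)] S[OF u(2)] M x in auto)
  qed (use Sb in blast)
qed

section \<open>The linearizing parametrization\<close>

text \<open>The closed ball of radius \<open>C\<close> in the weighted norm. An element is the
  deviation of a parametrized curve from the \<open>x\<close>-axis, that is, the parametrization
  minus \<open>(x, 0, 0)\<close>.\<close>

definition quadratic_curves :: "real \<Rightarrow> real \<Rightarrow> (complex \<Rightarrow> c3) set" where
  "quadratic_curves r C = {p. (\<lambda>x. fst (p x)) holomorphic_on ball 0 r \<and>
     (\<lambda>x. fst (snd (p x))) holomorphic_on ball 0 r \<and> (\<lambda>x. snd (snd (p x))) holomorphic_on ball 0 r \<and>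
     (\<forall>x\<in>ball 0 r. norm (p x) \<le> C * (norm x)\<^sup>2)}"

text \<open>The contraction principle with bounds in place of a distance, since the curves are
  arbitrary outside the disc and a fixed point makes sense only on it. Completeness is the theorem
  that locally uniform limits of holomorphic functions are holomorphic; the weighted bounds imply
  uniform ones because the disc is bounded.\<close>

lemma quadratic_curves_fixpoint:
  fixes T :: "(complex \<Rightarrow> c3) \<Rightarrow> complex \<Rightarrow> c3"
  assumes "C \<ge> 0"
    and maps: "\<And>p. p \<in> quadratic_curves r C \<Longrightarrow> T p \<in> quadratic_curves r C"
    and contr: "\<And>p q e x. \<lbrakk>p \<in> quadratic_curves r C; q \<in> quadratic_curves r C;
       \<And>x. x \<in> ball 0 r \<Longrightarrow> norm (p x - q x) \<le> e * (norm x)\<^sup>2; x \<in> ball 0 r\<rbrakk>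
       \<Longrightarrow> norm (T p x - T q x) \<le> e / 2 * (norm x)\<^sup>2"
  obtains p where "p \<in> quadratic_curves r C" "\<And>x. x \<in> ball 0 r \<Longrightarrow> T p x = p x"
proof -
  define s where "s n = (T ^^ n) (\<lambda>_. 0)" for n
  have s_Suc: "s (Suc n) = T (s n)" for n by (simp add: s_def)
  have s: "s n \<in> quadratic_curves r C" for n
  proof (induction n)
    case 0
    show ?case using \<open>C \<ge> 0\<close> by (auto simp: s_def quadratic_curves_def)
  qed (simp add: s_Suc maps)
  \<comment> \<open>Since the iteration starts at 0, membership of \<open>s k\<close> already bounds
    its distance to \<open>s 0\<close> by \<open>C\<close>; each application of \<open>T\<close>
    halves this.\<close>
  have close: "norm (s (n + k) x - s n x) \<le> C / 2 ^ n * (norm x)\<^sup>2" if "x \<in> ball 0 r" for n k x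
    using that
  proof (induction n arbitrary: x)
    case 0
    then show ?case using s[of k] by (auto simp: s_def quadratic_curves_def)
  next
    case (Suc n)
    then show ?case
      using contr[OF s[of "n + k"] s[of n] Suc.IH Suc.prems] by (simp add: s_Suc field_simps)
  qed
  define l where "l x = (\<Sum>n. s (Suc n) x - s n x)" for x
  have ul: "uniform_limit (ball 0 r) s l sequentially"
  proof -
    have "uniform_limit (ball 0 r) (\<lambda>n x. \<Sum>i<n. s (Suc i) x - s i x) l sequentially"
      unfolding l_def
    proof (rule Weierstrass_m_test)
      show "norm (s (Suc n) x - s n x) \<le> C * r\<^sup>2 * (1 / 2) ^ n" if "x \<in> ball 0 r" for n x
      proof -
        have "norm (s (Suc n) x - s n x) \<le> C / 2 ^ n * (norm x)\<^sup>2" using close[OF that, of n 1] by simp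
        also have "\<dots> \<le> C / 2 ^ n * r\<^sup>2"
          using that \<open>C \<ge> 0\<close> by (intro mult_left_mono power_mono) auto
        finally show ?thesis by (simp add: power_divide mult.commute)
      qed
      show "summable (\<lambda>n. C * r\<^sup>2 * (1 / 2) ^ n)"
        by (intro summable_mult summable_geometric) simp
    qed
    moreover have "(\<Sum>i<n. s (Suc i) x - s i x) = s n x" for n x
      using sum_lessThan_telescope[of "\<lambda>i. s i x" n] by (simp add: s_def)
    ultimately show ?thesis by simp
  qed
  have lim: "(\<lambda>n. s n x) \<longlonglongrightarrow> l x" if "x \<in> ball 0 r" for x
    using ul that by (rule tendsto_uniform_limitI)
  have hol: "(\<lambda>x. L (l x)) holomorphic_on ball 0 r"
    if L: "bounded_linear L" and "\<And>n. (\<lambda>x. L (s n x)) holomorphic_on ball 0 r" for L :: "c3 \<Rightarrow> complex"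
  proof (rule holomorphic_uniform_sequence[OF open_ball, of "\<lambda>n x. L (s n x)"])
    fix x :: complex assume "x \<in> ball 0 r"
    then obtain d where "d > 0" "cball x d \<subseteq> ball 0 r" by (meson open_ball open_contains_cball)
    then show "\<exists>d>0. cball x d \<subseteq> ball 0 r \<and> uniform_limit (cball x d) (\<lambda>n x. L (s n x)) (\<lambda>x. L (l x)) sequentially"
      using bounded_linear.uniform_limit[OF L ul] uniform_limit_on_subset by blast
  qed (use that in auto)
  have l: "l \<in> quadratic_curves r C"
    unfolding quadratic_curves_def
  proof (intro CollectI conjI ballI)
    show "(\<lambda>x. fst (l x)) holomorphic_on ball 0 r"
      using s by (intro hol) (auto simp: quadratic_curves_def intro: bounded_linear_fst)
    show "(\<lambda>x. fst (snd (l x))) holomorphic_on ball 0 r"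
      using s by (intro hol)
       (auto simp: quadratic_curves_def intro: bounded_linear_fst_comp bounded_linear_snd)
    show "(\<lambda>x. snd (snd (l x))) holomorphic_on ball 0 r"
      using s by (intro hol)
       (auto simp: quadratic_curves_def intro: bounded_linear_snd_comp bounded_linear_snd)
    fix x :: complex assume x: "x \<in> ball 0 r"
    show "norm (l x) \<le> C * (norm x)\<^sup>2"
      using tendsto_norm[OF lim[OF x]]
      by (rule tendsto_upperbound) (use s x in \<open>auto simp: quadratic_curves_def\<close>)
  qed
  have "T l x = l x" if x: "x \<in> ball 0 r" for x
  proof -
    \<comment> \<open>Letting \<open>k\<close> tend to infinity in \<open>close\<close> bounds the
      distance to the limit. Applying \<open>T\<close> to both sides then shows that
      \<open>T l\<close> is also the limit of the iterates.\<close>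
    have rate: "norm (l x - s n x) \<le> C / 2 ^ n * (norm x)\<^sup>2" if x: "x \<in> ball 0 r" for n x
    proof (rule tendsto_upperbound[OF tendsto_norm[OF tendsto_diff[OF _ tendsto_const]]])
      show "(\<lambda>k. s (n + k) x) \<longlonglongrightarrow> l x"
        using LIMSEQ_ignore_initial_segment[OF lim[OF x], of n] by (simp add: add.commute)
    qed (use close[OF x] in auto)
    have "norm (T l x - s (Suc n) x) \<le> C * (norm x)\<^sup>2 * (1 / 2) ^ Suc n" for n
      using contr[OF l s[of n] rate[of _ n] x] by (simp add: s_Suc field_simps)
    then have bnd: "\<forall>\<^sub>F n in sequentially. norm (T l x - s (Suc n) x) \<le> C * (norm x)\<^sup>2 * (1 / 2) ^ Suc n"
      by (rule always_eventually[OF allI])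
    have "(\<lambda>n. C * (norm x)\<^sup>2 * (1 / 2) ^ Suc n) \<longlonglongrightarrow> C * (norm x)\<^sup>2 * 0"
      by (intro tendsto_intros LIMSEQ_Suc LIMSEQ_realpow_zero) auto
    then have "(\<lambda>n. T l x - s (Suc n) x) \<longlonglongrightarrow> 0"
      unfolding mult_zero_right by (rule Lim_null_comparison[OF bnd])
    moreover have "(\<lambda>n. T l x - s (Suc n) x) \<longlonglongrightarrow> T l x - l x"
      using LIMSEQ_Suc[OF lim[OF x]] by (intro tendsto_intros)
    ultimately have "T l x - l x = 0" using LIMSEQ_unique by blast
    then show ?thesis by simp
  qed
  then show thesis using that l by blast
qed

lemma norm_triple_le: "norm ((a, b, c) :: c3) \<le> norm a + norm b + norm c"
  using norm_Pair_le[of a "(b, c)"] norm_Pair_le[of b c] by simp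

lemma norm_triple_ge:
  "norm a \<le> norm ((a, b, c) :: c3)" "norm b \<le> norm ((a, b, c) :: c3)" "norm c \<le> norm ((a, b, c) :: c3)"
proof -
  show "norm a \<le> norm (a, b, c)" using norm_fst_le[of a "(b, c)"] by simp
  have "norm (b, c) \<le> norm (a, b, c)" using norm_snd_le[of "(b, c)" a] by simp
  then show "norm b \<le> norm (a, b, c)" "norm c \<le> norm (a, b, c)"
    using norm_fst_le[of b c] norm_snd_le[of c b] by simp_all
qed

lemma vanish2_compose_deriv:
  assumes "vanish2 k" "a 0 = 0" "b 0 = 0" "c 0 = 0"
    and "(a has_field_derivative a') (at 0)" "(b has_field_derivative b') (at 0)"
        "(c has_field_derivative c') (at 0)"
  shows "((\<lambda>x. k (a x, b x, c x)) has_field_derivative 0) (at 0)"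
proof -
  have "((\<lambda>x. (a x, b x, c x)) has_derivative (\<lambda>t. (a' * t, b' * t, c' * t))) (at 0)"
    using assms(5-7) by (intro has_derivative_Pair) (simp_all add: has_field_derivative_def)
  moreover have "(k has_derivative (\<lambda>_. 0)) (at (a 0, b 0, c 0))"
    using assms(1-4) by (simp add: vanish2_def zero_prod_def)
  ultimately have "((\<lambda>x. k (a x, b x, c x)) has_derivative (\<lambda>_. 0)) (at 0)"
    by (rule has_derivative_compose)
  then show ?thesis by (simp add: has_field_derivative_def lambda_zero)
qed

lemma linearizing_parametrization:
  assumes "w \<noteq> 0" "Re lam \<noteq> 0" and U: "open U" "0 \<in> U"
    and holo: "holo3_on f U" "holo3_on g U" "holo3_on h U"
    and van: "vanish2 f" "vanish2 g" "vanish2 h"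
  obtains r X Y Z where "r > 0"
    "X holomorphic_on ball 0 r" "Y holomorphic_on ball 0 r" "Z holomorphic_on ball 0 r"
    "X 0 = 0" "Y 0 = 0" "Z 0 = 0" "deriv X 0 = 1" "deriv Y 0 = 0" "deriv Z 0 = 0"
    "\<And>x. x \<in> ball 0 r \<Longrightarrow> (X x, Y x, Z x) \<in> U"
    "\<And>x. x \<in> ball 0 r \<Longrightarrow> sys w lam f g h (X x, Y x, Z x) =
       (\<i> * of_real w * x * deriv X x, \<i> * of_real w * x * deriv Y x, \<i> * of_real w * x * deriv Z x)"
proof -
  \<comment> \<open>The norm of the combined solution operator, one summand per component. In the
    first summand the right side is the new \<open>Y\<close> plus \<open>f\<close>, of size
    \<open>1 / |w| + 1\<close>, and is divided by \<open>|w|\<close> once more.\<close>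
  define \<kappa> where "\<kappa> = (1 / \<bar>w\<bar> + 1) / \<bar>w\<bar> + 1 / \<bar>w\<bar> + 1 / \<bar>Re lam\<bar>"
  have "\<kappa> > 0" unfolding \<kappa>_def using assms(1,2) by (intro add_pos_pos divide_pos_pos) auto
  \<comment> \<open>The Lipschitz constant for which \<open>\<kappa> * e = 1 / 2\<close>, the
    contraction factor.\<close>
  define e where "e = 1 / (2 * \<kappa>)"
  have "e > 0" using \<open>\<kappa> > 0\<close> by (simp add: e_def)
  obtain d1 d2 d3 where d: "d1 > 0" "ball 0 d1 \<subseteq> U" "d2 > 0" "d3 > 0"
    and lip: "\<And>p q. p \<in> ball 0 d1 \<Longrightarrow> q \<in> ball 0 d1 \<Longrightarrow> norm (f p - f q) \<le> e * norm (p - q)"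
       "\<And>p q. p \<in> ball 0 d2 \<Longrightarrow> q \<in> ball 0 d2 \<Longrightarrow> norm (g p - g q) \<le> e * norm (p - q)"
       "\<And>p q. p \<in> ball 0 d3 \<Longrightarrow> q \<in> ball 0 d3 \<Longrightarrow> norm (h p - h q) \<le> e * norm (p - q)"
    using vanish2_lipschitz[OF holo(1) U van(1) \<open>e > 0\<close>] vanish2_lipschitz[OF holo(2) U van(2) \<open>e > 0\<close>]
      vanish2_lipschitz[OF holo(3) U van(3) \<open>e > 0\<close>] by metis
  define \<delta> where "\<delta> = min d1 (min d2 d3)"
  have \<delta>: "\<delta> > 0" "ball 0 \<delta> \<subseteq> U" using d by (auto simp: \<delta>_def)
  \<comment> \<open>Along the \<open>x\<close>-axis the nonlinear terms have a double zero; this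
    bounds the first iterate and starts the estimate for all other curves.\<close>
  have axis: "\<exists>K\<ge>0. \<forall>x\<in>ball 0 (\<delta> / 2). norm (k (x, 0, 0)) \<le> K * (norm x)\<^sup>2"
    if k: "holo3_on k U" "vanish2 k" for k
  proof -
    have inU: "(x, 0, 0) \<in> U" if "x \<in> ball 0 \<delta>" for x
    proof -
      have "(x, 0, 0) \<in> ball (0::c3) \<delta>" using that by (simp add: norm_Pair)
      then show ?thesis using \<delta>(2) by blast
    qed
    then have "(\<lambda>x. k (x, 0, 0)) holomorphic_on ball 0 \<delta>"
      by (intro holo3_on_compose[OF k(1)]) (auto intro!: holomorphic_intros)
    moreover have "k (0, 0, 0) = 0" using k(2) by (simp add: vanish2_def zero_prod_def)
    moreover have "((\<lambda>x. k (x, 0, 0)) has_field_derivative 0) (at 0)"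
      by (rule vanish2_compose_deriv[OF k(2), of "\<lambda>x. x" "\<lambda>_. 0" "\<lambda>_. 0"]) (auto intro!: derivative_eq_intros)
    then have "deriv (\<lambda>x. k (x, 0, 0)) 0 = 0" by (rule DERIV_imp_deriv)
    ultimately show ?thesis using quadratic_on_subball[of "\<lambda>x. k (x, 0, 0)" \<delta> "\<delta> / 2"] \<delta>(1)
      by (metis field_sum_of_halves half_gt_zero less_add_same_cancel1)
  qed
  obtain K1 K2 K3 where "K1 \<ge> 0" "K2 \<ge> 0" "K3 \<ge> 0"
    and K123: "\<And>x. x \<in> ball 0 (\<delta> / 2) \<Longrightarrow> norm (f (x, 0, 0)) \<le> K1 * (norm x)\<^sup>2"
    "\<And>x. x \<in> ball 0 (\<delta> / 2) \<Longrightarrow> norm (g (x, 0, 0)) \<le> K2 * (norm x)\<^sup>2"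
    "\<And>x. x \<in> ball 0 (\<delta> / 2) \<Longrightarrow> norm (h (x, 0, 0)) \<le> K3 * (norm x)\<^sup>2"
    using axis[OF holo(1) van(1)] axis[OF holo(2) van(2)] axis[OF holo(3) van(3)] by metis
  define K where "K = K1 + K2 + K3"
  have "K \<ge> 0" using \<open>K1 \<ge> 0\<close> \<open>K2 \<ge> 0\<close> \<open>K3 \<ge> 0\<close> by (simp add: K_def)
  have K: "norm (f (x, 0, 0)) \<le> K * (norm x)\<^sup>2" "norm (g (x, 0, 0)) \<le> K * (norm x)\<^sup>2"
    "norm (h (x, 0, 0)) \<le> K * (norm x)\<^sup>2" if "x \<in> ball 0 (\<delta> / 2)" for x
    using K123[OF that] \<open>K1 \<ge> 0\<close> \<open>K2 \<ge> 0\<close> \<open>K3 \<ge> 0\<close> unfolding K_def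
    by (smt (verit, best) mult_right_mono zero_le_power2)+
  \<comment> \<open>On a curve of weighted size \<open>C\<close>, comparison with the axis bounds
    the nonlinear terms by \<open>N = K + e * C\<close>. As \<open>\<kappa> * e = 1 / 2\<close>, the
    choice \<open>C = 2 * \<kappa> * K\<close> solves \<open>\<kappa> * N = C\<close>, which makes
    the ball of radius \<open>C\<close> invariant.\<close>
  define C where "C = 2 * \<kappa> * K"
  have "C \<ge> 0" using \<open>\<kappa> > 0\<close> \<open>K \<ge> 0\<close> by (simp add: C_def)
  define N where "N = K + e * C"
  have N: "\<kappa> * N = C" using \<open>\<kappa> > 0\<close> by (simp add: N_def e_def C_def field_simps)
  \<comment> \<open>The bound 1 allows replacing the square of \<open>|x|\<close> by
    \<open>|x|\<close>, \<open>\<delta> / 2\<close> is the range of the axis estimate, and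
    \<open>\<delta> / (1 + C)\<close> keeps every curve in the ball where the Lipschitz constant is
    \<open>e\<close>.\<close>
  define r where "r = min 1 (min (\<delta> / 2) (\<delta> / (1 + C)))"
  have r: "r > 0" "r \<le> 1" "r \<le> \<delta> / 2" "r * (1 + C) \<le> \<delta>"
    using \<delta>(1) \<open>C \<ge> 0\<close> by (auto simp: r_def min_le_iff_disj field_simps min_mult_distrib_left)
  let ?P = "\<lambda>(p :: complex \<Rightarrow> c3) x. (x + fst (p x), fst (snd (p x)), snd (snd (p x)))"
  have P_eq: "?P p x = (x, 0, 0) + p x" for p and x :: complex
    by (simp add: prod_eq_iff)
  have P_in: "?P p x \<in> ball 0 \<delta>" if p: "p \<in> quadratic_curves r C" and x: "x \<in> ball 0 r" for p x
  proof -
    have "norm (?P p x) \<le> norm x + norm (p x)"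
      unfolding P_eq using norm_triangle_ineq[of "(x, 0, 0)" "p x"] by (simp add: norm_Pair)
    also have "\<dots> \<le> norm x + C * (norm x)\<^sup>2" using p x by (auto simp: quadratic_curves_def)
    also have "\<dots> \<le> norm x + C * norm x"
      using x r \<open>C \<ge> 0\<close> by (intro add_left_mono mult_left_mono) (auto simp: power2_eq_square intro: mult_left_le_one_le)
    also have "\<dots> = norm x * (1 + C)" by (simp add: algebra_simps)
    also have "\<dots> < r * (1 + C)" using x \<open>C \<ge> 0\<close> by (intro mult_strict_right_mono) auto
    finally show ?thesis using r by simp
  qed
  have zero_in: "(\<lambda>_. 0) \<in> quadratic_curves r C" using \<open>C \<ge> 0\<close> by (auto simp: quadratic_curves_def)
  have nonlin: "quadratic_on r (\<lambda>x. k (?P p x)) \<and> (\<forall>x\<in>ball 0 r. norm (k (?P p x)) \<le> N * (norm x)\<^sup>2)"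
    if k: "holo3_on k U" and Kk: "\<And>x. x \<in> ball 0 (\<delta> / 2) \<Longrightarrow> norm (k (x, 0, 0)) \<le> K * (norm x)\<^sup>2"
      and lipk: "\<And>p q. p \<in> ball 0 \<delta> \<Longrightarrow> q \<in> ball 0 \<delta> \<Longrightarrow> norm (k p - k q) \<le> e * norm (p - q)"
      and p: "p \<in> quadratic_curves r C" for k p
  proof -
    have "norm (k (?P p x)) \<le> N * (norm x)\<^sup>2" if x: "x \<in> ball 0 r" for x
    proof -
      have "norm (k (?P p x)) \<le> norm (k (x, 0, 0)) + norm (k (?P p x) - k (x, 0, 0))"
        by (metis norm_triangle_sub)
      also have "norm (k (?P p x) - k (x, 0, 0)) \<le> e * norm (?P p x - (x, 0, 0))"
        using lipk[OF P_in[OF p x] P_in[OF zero_in x]] by simp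
      also have "norm (?P p x - (x, 0, 0)) = norm (p x)" unfolding P_eq by simp
      also have "e * norm (p x) \<le> e * (C * (norm x)\<^sup>2)"
        using p x \<open>e > 0\<close> by (intro mult_left_mono) (auto simp: quadratic_curves_def)
      finally show ?thesis using Kk[of x] x r by (simp add: N_def algebra_simps)
    qed
    moreover have "(\<lambda>x. k (?P p x)) holomorphic_on ball 0 r"
      using p P_in[OF p] \<delta>(2) by (intro holo3_on_compose[OF k])
        (auto simp: quadratic_curves_def simp del: mem_ball mem_ball_0 intro!: holomorphic_intros)
    ultimately show ?thesis by (blast intro: quadratic_onI)
  qed
  have lipP: "norm (k (?P p x) - k (?P q x)) \<le> (e * E) * (norm x)\<^sup>2"
    if lipk: "\<And>p q. p \<in> ball 0 \<delta> \<Longrightarrow> q \<in> ball 0 \<delta> \<Longrightarrow> norm (k p - k q) \<le> e * norm (p - q)"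
      and pq: "p \<in> quadratic_curves r C" "q \<in> quadratic_curves r C" and x: "x \<in> ball 0 r"
      and E: "norm (p x - q x) \<le> E * (norm x)\<^sup>2" for k :: "c3 \<Rightarrow> complex" and p q x E
  proof -
    have "norm (k (?P p x) - k (?P q x)) \<le> e * norm (?P p x - ?P q x)"
      using lipk[OF P_in[OF pq(1) x] P_in[OF pq(2) x]] .
    also have "?P p x - ?P q x = p x - q x" unfolding P_eq by simp
    also have "e * norm (p x - q x) \<le> e * (E * (norm x)\<^sup>2)" using E \<open>e > 0\<close> by (intro mult_left_mono) auto
    finally show ?thesis by (simp add: mult.assoc)
  qed
  have lip\<delta>: "norm (f p - f q) \<le> e * norm (p - q)" "norm (g p - g q) \<le> e * norm (p - q)"
    "norm (h p - h q) \<le> e * norm (p - q)" if "p \<in> ball 0 \<delta>" "q \<in> ball 0 \<delta>" for p q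
    using lip[of p q] that by (auto simp: \<delta>_def)
  define F where "F p x = f (?P p x)" for p x
  define G where "G p x = g (?P p x)" for p x
  define H where "H p x = h (?P p x)" for p x
  have FGH: "quadratic_on r (F p)" "quadratic_on r (G p)" "quadratic_on r (H p)"
    and FGHN: "\<And>x. x \<in> ball 0 r \<Longrightarrow> norm (F p x) \<le> N * (norm x)\<^sup>2"
       "\<And>x. x \<in> ball 0 r \<Longrightarrow> norm (G p x) \<le> N * (norm x)\<^sup>2"
       "\<And>x. x \<in> ball 0 r \<Longrightarrow> norm (H p x) \<le> N * (norm x)\<^sup>2"
    if p: "p \<in> quadratic_curves r C" for p
    using nonlin[OF holo(1) K(1) lip\<delta>(1) p] nonlin[OF holo(2) K(2) lip\<delta>(2) p] nonlin[OF holo(3) K(3) lip\<delta>(3) p]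
    unfolding F_def G_def H_def by blast+
  obtain S where S: "\<And>u. quadratic_on r u \<Longrightarrow> quadratic_on r (S u)"
      "\<And>u x. \<lbrakk>quadratic_on r u; x \<in> ball 0 r\<rbrakk> \<Longrightarrow> \<i> * of_real w * x * deriv (S u) x - \<i> * of_real w * S u x = u x"
      "\<And>u M x. \<lbrakk>quadratic_on r u; \<And>x. x \<in> ball 0 r \<Longrightarrow> norm (u x) \<le> M * (norm x)\<^sup>2; x \<in> ball 0 r\<rbrakk>
           \<Longrightarrow> norm (S u x) \<le> M / \<bar>w\<bar> * (norm x)\<^sup>2"
      "\<And>u u' M x. \<lbrakk>quadratic_on r u; quadratic_on r u';
           \<And>x. x \<in> ball 0 r \<Longrightarrow> norm (u x - u' x) \<le> M * (norm x)\<^sup>2; x \<in> ball 0 r\<rbrakk>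
           \<Longrightarrow> norm (S u x - S u' x) \<le> M / \<bar>w\<bar> * (norm x)\<^sup>2"
  proof (rule euler_equation_solver[of r "\<bar>w\<bar>" w "\<i> * of_real w" "\<bar>w\<bar>"])
    show "\<bar>w\<bar> \<le> norm (\<i> * of_real w * of_nat n - \<i> * of_real w)" if "n \<ge> 2" for n
    proof -
      have "\<i> * of_real w * of_nat n - \<i> * of_real w = \<i> * of_real (w * (real n - 1))"
        by (simp add: algebra_simps)
      then have "norm (\<i> * of_real w * of_nat n - \<i> * of_real w) = \<bar>w\<bar> * (real n - 1)"
        using that by (simp only: norm_mult norm_of_real) (simp add: abs_mult)
      moreover have "\<bar>w\<bar> * 1 \<le> \<bar>w\<bar> * (real n - 1)" using that by (intro mult_left_mono) auto
      ultimately show ?thesis by simp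
    qed
    show "norm (v x) \<le> M / \<bar>w\<bar> * (norm x)\<^sup>2" if "v holomorphic_on ball 0 r" "v 0 = 0" "deriv v 0 = 0"
       "\<And>x. x \<in> ball 0 r \<Longrightarrow> \<i> * of_real w * x * deriv v x - \<i> * of_real w * v x = u x"
       "\<And>x. x \<in> ball 0 r \<Longrightarrow> norm (u x) \<le> M * (norm x)\<^sup>2" "x \<in> ball 0 r" for u v M x
      using euler_equation_bound_resonant[OF that(1-3) \<open>w \<noteq> 0\<close> that(4-6)] .
  qed (use r \<open>w \<noteq> 0\<close> in auto)
  obtain S' where S': "\<And>u. quadratic_on r u \<Longrightarrow> quadratic_on r (S' u)"
      "\<And>u x. \<lbrakk>quadratic_on r u; x \<in> ball 0 r\<rbrakk> \<Longrightarrow> \<i> * of_real w * x * deriv (S' u) x - lam * S' u x = u x"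
      "\<And>u M x. \<lbrakk>quadratic_on r u; \<And>x. x \<in> ball 0 r \<Longrightarrow> norm (u x) \<le> M * (norm x)\<^sup>2; x \<in> ball 0 r\<rbrakk>
           \<Longrightarrow> norm (S' u x) \<le> M / \<bar>Re lam\<bar> * (norm x)\<^sup>2"
      "\<And>u u' M x. \<lbrakk>quadratic_on r u; quadratic_on r u';
           \<And>x. x \<in> ball 0 r \<Longrightarrow> norm (u x - u' x) \<le> M * (norm x)\<^sup>2; x \<in> ball 0 r\<rbrakk>
           \<Longrightarrow> norm (S' u x - S' u' x) \<le> M / \<bar>Re lam\<bar> * (norm x)\<^sup>2"
  proof (rule euler_equation_solver[of r "\<bar>Re lam\<bar>" w lam "\<bar>Re lam\<bar>"])
    show "\<bar>Re lam\<bar> \<le> norm (\<i> * of_real w * of_nat n - lam)" for n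
      using abs_Re_le_cmod[of "\<i> * of_real w * of_nat n - lam"] by simp
    show "norm (v x) \<le> M / \<bar>Re lam\<bar> * (norm x)\<^sup>2" if "v holomorphic_on ball 0 r" "v 0 = 0" "deriv v 0 = 0"
       "\<And>x. x \<in> ball 0 r \<Longrightarrow> \<i> * of_real w * x * deriv v x - lam * v x = u x"
       "\<And>x. x \<in> ball 0 r \<Longrightarrow> norm (u x) \<le> M * (norm x)\<^sup>2" "x \<in> ball 0 r" for u v M x
      using euler_equation_bound_hyperbolic[OF that(1) \<open>Re lam \<noteq> 0\<close> that(4-6)] .
  qed (use r \<open>Re lam \<noteq> 0\<close> in auto)
  define Ty where "Ty p = S (G p)" for p
  \<comment> \<open>The updated \<open>Ty p\<close> is used, not the \<open>y\<close>-component of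
    \<open>p\<close>: two values of \<open>Ty\<close> differ by a multiple of \<open>e\<close>,
    whereas two values of \<open>p\<close> carry no small factor.\<close>
  define Tx where "Tx p = S (\<lambda>x. Ty p x + F p x)" for p
  define Tz where "Tz p = S' (H p)" for p
  define T where "T p x = (Tx p x, Ty p x, Tz p x)" for p x
  have Tq: "quadratic_on r (Ty p)" "quadratic_on r (\<lambda>x. Ty p x + F p x)" "quadratic_on r (Tx p)" "quadratic_on r (Tz p)"
    if p: "p \<in> quadratic_curves r C" for p
    unfolding Tx_def Ty_def Tz_def using FGH[OF p] by (auto intro!: S(1) S'(1) quadratic_on_add)
  have sum_\<kappa>: "(N / \<bar>w\<bar> + N) / \<bar>w\<bar> * n + N / \<bar>w\<bar> * n + N / \<bar>Re lam\<bar> * n = \<kappa> * N * n" for N n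
    by (simp add: \<kappa>_def algebra_simps add_divide_distrib)
  have maps: "T p \<in> quadratic_curves r C" if p: "p \<in> quadratic_curves r C" for p
  proof -
    have "norm (T p x) \<le> C * (norm x)\<^sup>2" if x: "x \<in> ball 0 r" for x
    proof -
      have y: "norm (Ty p x) \<le> N / \<bar>w\<bar> * (norm x)\<^sup>2" if "x \<in> ball 0 r" for x
        unfolding Ty_def using FGH(2)[OF p] FGHN(2)[OF p] that by (rule S(3))
      have "norm (Ty p x + F p x) \<le> (N / \<bar>w\<bar> + N) * (norm x)\<^sup>2" if "x \<in> ball 0 r" for x
        using norm_triangle_ineq[of "Ty p x" "F p x"] y[OF that] FGHN(1)[OF p that] by (simp add: algebra_simps)
      then have "norm (Tx p x) \<le> (N / \<bar>w\<bar> + N) / \<bar>w\<bar> * (norm x)\<^sup>2"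
        unfolding Tx_def using Tq(2)[OF p] x by (intro S(3)) auto
      moreover have "norm (Tz p x) \<le> N / \<bar>Re lam\<bar> * (norm x)\<^sup>2"
        unfolding Tz_def using FGH(3)[OF p] FGHN(3)[OF p] x by (rule S'(3))
      ultimately show ?thesis
        using norm_triple_le[of "Tx p x" "Ty p x" "Tz p x"] y[OF x] sum_\<kappa>[of N "(norm x)\<^sup>2"] N
        by (simp add: T_def)
    qed
    then show ?thesis using Tq[OF p] by (simp add: quadratic_curves_def T_def quadratic_on_def)
  qed
  have contr: "norm (T p x - T q x) \<le> E / 2 * (norm x)\<^sup>2"
    if pq: "p \<in> quadratic_curves r C" "q \<in> quadratic_curves r C"
      and E: "\<And>x. x \<in> ball 0 r \<Longrightarrow> norm (p x - q x) \<le> E * (norm x)\<^sup>2" and x: "x \<in> ball 0 r" for p q E x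
  proof -
    have l: "norm (F p x - F q x) \<le> e * E * (norm x)\<^sup>2" "norm (G p x - G q x) \<le> e * E * (norm x)\<^sup>2"
       "norm (H p x - H q x) \<le> e * E * (norm x)\<^sup>2" if "x \<in> ball 0 r" for x
      unfolding F_def G_def H_def
      using lipP[OF lip\<delta>(1) pq that E[OF that]] lipP[OF lip\<delta>(2) pq that E[OF that]]
        lipP[OF lip\<delta>(3) pq that E[OF that]] by simp_all
    have y: "norm (Ty p x - Ty q x) \<le> e * E / \<bar>w\<bar> * (norm x)\<^sup>2" if "x \<in> ball 0 r" for x
      unfolding Ty_def using FGH(2)[OF pq(1)] FGH(2)[OF pq(2)] l(2) that by (rule S(4))
    have "norm (Ty p x + F p x - (Ty q x + F q x)) \<le> (e * E / \<bar>w\<bar> + e * E) * (norm x)\<^sup>2" if "x \<in> ball 0 r" for x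
      using norm_triangle_ineq[of "Ty p x - Ty q x" "F p x - F q x"] y[OF that] l(1)[OF that]
      by (simp add: algebra_simps)
    then have "norm (Tx p x - Tx q x) \<le> (e * E / \<bar>w\<bar> + e * E) / \<bar>w\<bar> * (norm x)\<^sup>2"
      unfolding Tx_def using Tq(2)[OF pq(1)] Tq(2)[OF pq(2)] x by (intro S(4)) auto
    moreover have "norm (Tz p x - Tz q x) \<le> e * E / \<bar>Re lam\<bar> * (norm x)\<^sup>2"
      unfolding Tz_def using FGH(3)[OF pq(1)] FGH(3)[OF pq(2)] l(3) x by (rule S'(4))
    moreover have "norm (T p x - T q x) \<le> norm (Tx p x - Tx q x) + norm (Ty p x - Ty q x) + norm (Tz p x - Tz q x)"
      by (simp add: T_def norm_triple_le)
    moreover have "\<kappa> * (e * E) * (norm x)\<^sup>2 = E / 2 * (norm x)\<^sup>2" using \<open>\<kappa> > 0\<close> by (simp add: e_def)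
    ultimately show ?thesis
      using y[OF x] sum_\<kappa>[of "e * E" "(norm x)\<^sup>2"] by linarith
  qed
  obtain p where p: "p \<in> quadratic_curves r C" and fixp: "\<And>x. x \<in> ball 0 r \<Longrightarrow> T p x = p x"
    by (rule quadratic_curves_fixpoint[of C r T, OF \<open>C \<ge> 0\<close> maps contr]) auto
  define X where "X x = x + Tx p x" for x
  have P_fix: "?P p x = (X x, Ty p x, Tz p x)" if "x \<in> ball 0 r" for x
    using fixp[OF that] unfolding T_def X_def by (metis fst_conv snd_conv)
  have hol: "Tx p holomorphic_on ball 0 r" "Ty p holomorphic_on ball 0 r" "Tz p holomorphic_on ball 0 r"
    using Tq[OF p] by (auto simp: quadratic_on_def)
  have dX: "deriv X x = 1 + deriv (Tx p) x" if "x \<in> ball 0 r" for x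
    unfolding X_def
    by (rule DERIV_imp_deriv) (auto intro!: derivative_eq_intros holomorphic_derivI[OF hol(1) open_ball that])
  show thesis
  proof
    show "r > 0" by fact
    show "X holomorphic_on ball 0 r" unfolding X_def using hol(1) by (intro holomorphic_intros)
    show "X 0 = 0" using quadratic_on_at_0(1)[OF Tq(3)[OF p] \<open>r > 0\<close>] by (simp add: X_def)
    show "deriv X 0 = 1" using dX[of 0] \<open>r > 0\<close> quadratic_on_at_0(2)[OF Tq(3)[OF p] \<open>r > 0\<close>] by simp
    fix x :: complex assume x: "x \<in> ball 0 r"
    show "(X x, Ty p x, Tz p x) \<in> U" using P_in[OF p x] \<delta>(2) unfolding P_fix[OF x] by blast
    have "\<i> * of_real w * x * deriv (Tx p) x - \<i> * of_real w * Tx p x = Ty p x + f (X x, Ty p x, Tz p x)"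
      using S(2)[OF Tq(2)[OF p] x] unfolding Tx_def[symmetric] unfolding F_def P_fix[OF x] .
    moreover have "\<i> * of_real w * x * deriv (Ty p) x - \<i> * of_real w * Ty p x = g (X x, Ty p x, Tz p x)"
      using S(2)[OF FGH(2)[OF p] x] unfolding Ty_def[symmetric] unfolding G_def P_fix[OF x] .
    moreover have "\<i> * of_real w * x * deriv (Tz p) x - lam * Tz p x = h (X x, Ty p x, Tz p x)"
      using S'(2)[OF FGH(3)[OF p] x] unfolding Tz_def[symmetric] unfolding H_def P_fix[OF x] .
    ultimately show "sys w lam f g h (X x, Ty p x, Tz p x) =
       (\<i> * of_real w * x * deriv X x, \<i> * of_real w * x * deriv (Ty p) x, \<i> * of_real w * x * deriv (Tz p) x)"
      using dX[OF x] by (simp add: sys_def X_def algebra_simps)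
  qed (use hol quadratic_on_at_0[OF Tq(1)[OF p] \<open>r > 0\<close>] quadratic_on_at_0[OF Tq(4)[OF p] \<open>r > 0\<close>] in auto)
qed

section \<open>Uniqueness of trajectories\<close>

text \<open>The set where the solutions agree is closed in \<open>I\<close> by continuity and open
  because, on a short interval around a common point, the mean value inequality can be iterated: any
  bound for the difference improves by a factor 2. Connectedness of \<open>I\<close> does the
  rest.\<close>

lemma ode_solutions_agree:
  fixes F :: "'a::real_normed_vector \<Rightarrow> 'a" and u v :: "real \<Rightarrow> 'a"
  assumes lip: "\<And>p. p \<in> U \<Longrightarrow> \<exists>\<delta>>0. \<exists>L. \<forall>q\<in>ball p \<delta>. \<forall>q'\<in>ball p \<delta>. norm (F q - F q') \<le> L * norm (q - q')"
    and I: "is_interval I" "t0 \<in> I" "t \<in> I"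
    and u: "\<And>t. t \<in> I \<Longrightarrow> (u has_vector_derivative F (u t)) (at t within I)" "\<And>t. t \<in> I \<Longrightarrow> u t \<in> U"
    and v: "\<And>t. t \<in> I \<Longrightarrow> (v has_vector_derivative F (v t)) (at t within I)"
    and "u t0 = v t0"
  shows "u t = v t"
proof -
  have cont: "continuous_on I u" "continuous_on I v"
    using u(1) v by (auto intro!: has_vector_derivative_continuous simp: continuous_on_eq_continuous_within)
  let ?E = "I \<inter> (\<lambda>t. u t - v t) -` {0}"
  have "closedin (top_of_set I) ?E"
    using cont by (intro continuous_closedin_preimage continuous_on_diff) auto
  moreover have "openin (top_of_set I) ?E"
    unfolding openin_contains_ball
  proof (intro conjI ballI)
    fix t assume "t \<in> ?E"
    then have t: "t \<in> I" "u t = v t" by auto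
    obtain \<delta> L0 where \<delta>: "\<delta> > 0"
      and L0: "\<And>q q'. q \<in> ball (u t) \<delta> \<Longrightarrow> q' \<in> ball (u t) \<delta> \<Longrightarrow> norm (F q - F q') \<le> L0 * norm (q - q')"
      using lip[OF u(2)[OF t(1)]] by blast
    define L where "L = \<bar>L0\<bar> + 1"
    have L: "norm (F q - F q') \<le> L * norm (q - q')" if "q \<in> ball (u t) \<delta>" "q' \<in> ball (u t) \<delta>" for q q'
      using order_trans[OF L0[OF that] mult_right_mono[of L0 L "norm (q - q')"]] by (auto simp: L_def)
    have "L > 0" by (simp add: L_def)
    obtain e1 e2 where e: "e1 > 0" "e2 > 0" "\<And>s. s \<in> I \<Longrightarrow> dist s t < e1 \<Longrightarrow> dist (u s) (u t) < \<delta>"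
      "\<And>s. s \<in> I \<Longrightarrow> dist s t < e2 \<Longrightarrow> dist (v s) (v t) < \<delta>"
      using cont t(1) \<delta> unfolding continuous_on_iff by metis
    \<comment> \<open>Continuity keeps both solutions in the ball where \<open>F\<close> is
      Lipschitz, and length \<open>1 / (2 * L)\<close> makes the factor \<open>L * |s - t|\<close>
      at most one half.\<close>
    define \<epsilon> where "\<epsilon> = min (min e1 e2) (1 / (2 * L))"
    have "\<epsilon> > 0" using e \<open>L > 0\<close> by (simp add: \<epsilon>_def)
    let ?J = "ball t \<epsilon> \<inter> I"
    have near: "u s \<in> ball (u t) \<delta>" "v s \<in> ball (u t) \<delta>" "s \<in> I" if "s \<in> ?J" for s
      using that e(3)[of s] e(4)[of s] t(2) by (auto simp: \<epsilon>_def dist_commute)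
    have J: "convex ?J" "t \<in> ?J"
      using I(1) t(1) \<open>\<epsilon> > 0\<close> by (auto intro!: convex_Int simp: is_interval_convex)
    have "norm (u s - v s) \<le> 2 * \<delta> / 2 ^ n" if "s \<in> ?J" for n s
      using that
    proof (induction n arbitrary: s)
      case 0
      have "norm (u s - v s) \<le> norm (u s - u t) + norm (u t - v s)"
        by (metis diff_add_cancel add_diff_eq norm_triangle_ineq)
      also have "\<dots> \<le> \<delta> + \<delta>" using near[OF 0] by (intro add_mono) (auto simp: dist_norm norm_minus_commute)
      finally show ?case by simp
    next
      case (Suc n)
      define b where "b = L * (2 * \<delta> / 2 ^ n)"
      have "b \<ge> 0" using \<open>L > 0\<close> \<delta> by (simp add: b_def)
      have "norm ((u s - v s) - (u t - v t)) \<le> b * norm (s - t)"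
      proof (rule differentiable_bound[where f' = "\<lambda>s h. h *\<^sub>R (F (u s) - F (v s))", OF J(1) _ _ Suc.prems J(2)])
        fix s assume s: "s \<in> ?J"
        have "((\<lambda>s. u s - v s) has_vector_derivative (F (u s) - F (v s))) (at s within I)"
          using u(1) v near(3)[OF s] by (intro has_vector_derivative_diff) auto
        then show "((\<lambda>s. u s - v s) has_derivative (\<lambda>h. h *\<^sub>R (F (u s) - F (v s)))) (at s within ?J)"
          unfolding has_vector_derivative_def by (rule has_derivative_subset) auto
        have "norm (F (u s) - F (v s)) \<le> L * norm (u s - v s)" using L near[OF s] by blast
        also have "\<dots> \<le> b" unfolding b_def using Suc.IH[OF s] \<open>L > 0\<close> by (intro mult_left_mono) auto
        finally show "onorm (\<lambda>h. h *\<^sub>R (F (u s) - F (v s))) \<le> b"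
          using \<open>b \<ge> 0\<close> by (intro onorm_bound) (auto intro: mult_left_mono simp: mult.commute[of b])
      qed
      also have "\<dots> \<le> b * (1 / (2 * L))"
        using Suc.prems \<open>b \<ge> 0\<close> by (intro mult_left_mono) (auto simp: \<epsilon>_def dist_real_def abs_minus_commute)
      also have "\<dots> = 2 * \<delta> / 2 ^ Suc n" using \<open>L > 0\<close> by (simp add: b_def)
      finally show ?case using t(2) by simp
    qed
    moreover have "(\<lambda>n. 2 * \<delta> / 2 ^ n) \<longlonglongrightarrow> 0"
      using tendsto_mult[OF tendsto_const[of "2 * \<delta>"] LIMSEQ_inverse_realpow_zero[of 2]]
      by (simp add: divide_inverse)
    ultimately have "norm (u s - v s) \<le> 0" if "s \<in> ?J" for s
      using that by (meson LIMSEQ_le_const)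
    then show "\<exists>e>0. ball t e \<inter> I \<subseteq> ?E" using \<open>\<epsilon> > 0\<close> by (intro exI[of _ \<epsilon>]) auto
  qed auto
  moreover have "connected I" using I(1) is_interval_connected by blast
  ultimately have "?E = {} \<or> ?E = I" unfolding connected_clopen by blast
  then show ?thesis using I \<open>u t0 = v t0\<close> by auto
qed

text \<open>Only pointwise differentiability is given, so the derivative has no evident local bound.
  Continuity at \<open>p\<close> bounds \<open>f\<close> nearby, and Cauchy's estimate converts this
  into a bound on the derivative.\<close>

lemma holo3_on_locally_lipschitz:
  assumes "holo3_on f U" "open U" "p \<in> U"
  shows "\<exists>\<delta>>0. \<exists>L. \<forall>q\<in>ball p \<delta>. \<forall>q'\<in>ball p \<delta>. norm (f q - f q') \<le> L * norm (q - q')"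
proof -
  have "isCont f p" using assms(1,3) unfolding holo3_on_def by (meson has_derivative_continuous)
  then obtain d where d: "d > 0" "\<And>q. dist q p < d \<Longrightarrow> dist (f q) (f p) < 1"
    unfolding continuous_at_eps_delta using zero_less_one by blast
  obtain d' where d': "d' > 0" "ball p d' \<subseteq> U" using assms(2,3) open_contains_ball by blast
  define \<delta> where "\<delta> = min d d' / 3"
  have \<delta>: "\<delta> > 0" "3 * \<delta> \<le> d" "3 * \<delta> \<le> d'" using d d' by (auto simp: \<delta>_def)
  have "holo3_on f (ball p (3 * \<delta>))"
    using assms(1) d' \<delta> unfolding holo3_on_def by (meson subset_ball subset_iff)
  moreover have "norm (f q) \<le> norm (f p) + 1" if "q \<in> ball p (3 * \<delta>)" for q
  proof -
    have "dist (f q) (f p) < 1" using that \<delta> by (intro d(2)) (simp add: dist_commute)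
    then show ?thesis using norm_triangle_sub[of "f q" "f p"] by (simp add: dist_norm)
  qed
  ultimately show ?thesis using holo3_on_lipschitz[of f p \<delta> "norm (f p) + 1"] \<delta>(1) by blast
qed

lemma sys_locally_lipschitz:
  assumes "open U" "holo3_on f U" "holo3_on g U" "holo3_on h U" "p \<in> U"
  shows "\<exists>\<delta>>0. \<exists>L. \<forall>q\<in>ball p \<delta>. \<forall>q'\<in>ball p \<delta>.
     norm (sys w lam f g h q - sys w lam f g h q') \<le> L * norm (q - q')"
proof -
  obtain d1 d2 d3 L1 L2 L3 where d: "d1 > 0" "d2 > 0" "d3 > 0"
    and l: "\<And>q q'. q \<in> ball p d1 \<Longrightarrow> q' \<in> ball p d1 \<Longrightarrow> norm (f q - f q') \<le> L1 * norm (q - q')"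
       "\<And>q q'. q \<in> ball p d2 \<Longrightarrow> q' \<in> ball p d2 \<Longrightarrow> norm (g q - g q') \<le> L2 * norm (q - q')"
       "\<And>q q'. q \<in> ball p d3 \<Longrightarrow> q' \<in> ball p d3 \<Longrightarrow> norm (h q - h q') \<le> L3 * norm (q - q')"
    using holo3_on_locally_lipschitz[OF assms(2,1,5)] holo3_on_locally_lipschitz[OF assms(3,1,5)]
      holo3_on_locally_lipschitz[OF assms(4,1,5)] by metis
  let ?d = "min d1 (min d2 d3)" and ?L = "(\<bar>w\<bar> + 1 + L1) + (\<bar>w\<bar> + L2) + (norm lam + L3)"
  have "norm (sys w lam f g h q - sys w lam f g h q') \<le> ?L * norm (q - q')"
    if q: "q \<in> ball p ?d" "q' \<in> ball p ?d" for q q'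
  proof -
    obtain x y z x' y' z' where qq: "q = (x, y, z)" "q' = (x', y', z')" by (cases q, cases q') auto
    let ?n = "norm (q - q')"
    have n: "norm (x - x') \<le> ?n" "norm (y - y') \<le> ?n" "norm (z - z') \<le> ?n"
      using norm_triple_ge[where a = "x - x'" and b = "y - y'" and c = "z - z'"] by (simp_all add: qq)
    have lq: "norm (f q - f q') \<le> L1 * ?n" "norm (g q - g q') \<le> L2 * ?n" "norm (h q - h q') \<le> L3 * ?n"
      using l q by auto
    have m: "norm (\<i> * of_real w * (x - x')) \<le> \<bar>w\<bar> * ?n" "norm (\<i> * of_real w * (y - y')) \<le> \<bar>w\<bar> * ?n"
      "norm (lam * (z - z')) \<le> norm lam * ?n"
      using n by (simp_all add: norm_mult mult_left_mono)
    have "sys w lam f g h q - sys w lam f g h q' =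
      (\<i> * of_real w * (x - x') + (y - y') + (f q - f q'), \<i> * of_real w * (y - y') + (g q - g q'),
        lam * (z - z') + (h q - h q'))"
      by (simp add: sys_def qq algebra_simps)
    then have "norm (sys w lam f g h q - sys w lam f g h q') \<le>
      norm (\<i> * of_real w * (x - x') + (y - y') + (f q - f q')) +
      norm (\<i> * of_real w * (y - y') + (g q - g q')) + norm (lam * (z - z') + (h q - h q'))"
      using norm_triple_le by metis
    also have "\<dots> \<le> (\<bar>w\<bar> * ?n + ?n + L1 * ?n) + (\<bar>w\<bar> * ?n + L2 * ?n) + (norm lam * ?n + L3 * ?n)"
      by (intro add_mono norm_triangle_mono m lq n)
    finally show ?thesis by (simp add: algebra_simps)
  qed
  then show ?thesis using d by (intro exI[of _ ?d] conjI exI[of _ ?L]) auto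
qed

section \<open>Uniqueness of the center manifold\<close>

text \<open>A nonconstant \<open>f\<close> would be \<open>x ^ n * g\<close> with \<open>g\<close>
  nowhere zero near 0, while divisibility by \<open>x ^ Suc n\<close> forces
  \<open>g 0 = 0\<close>.\<close>

lemma holomorphic_flat_eq_0:
  assumes f: "f holomorphic_on ball 0 r" 
    and flat: "\<And>m. \<exists>a. a holomorphic_on ball 0 r \<and> (\<forall>x\<in>ball 0 r. f x = x ^ m * a x)"
    and x: "x \<in> ball 0 r"
  shows "f x = 0"
proof -
  have "r > 0" using x by (auto intro: le_less_trans[OF norm_ge_zero])
  have f0: "f 0 = 0" using flat[of 1] \<open>r > 0\<close> by auto
  have "f constant_on ball 0 r"
  proof (rule ccontr)
    assume nc: "\<not> f constant_on ball 0 r"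
    have "(0::complex) \<in> ball 0 r" using \<open>r > 0\<close> by simp
    obtain g s n where g: "0 < n" "0 < s" "ball (0::complex) s \<subseteq> ball 0 r" "g holomorphic_on ball 0 s"
      "\<And>w. w \<in> ball 0 s \<Longrightarrow> f w = (w - 0) ^ n * g w" "\<And>w. w \<in> ball 0 s \<Longrightarrow> g w \<noteq> 0"
      by (rule holomorphic_factor_zero_nonconstant[OF f open_ball connected_ball \<open>0 \<in> ball 0 r\<close> f0 nc]) (rule that)
    obtain a where a: "a holomorphic_on ball 0 r" "\<And>x. x \<in> ball 0 r \<Longrightarrow> f x = x ^ Suc n * a x"
      using flat by blast
    have lim: "g \<midarrow>0\<rightarrow> g 0" "(\<lambda>w. w * a w) \<midarrow>0\<rightarrow> 0 * a 0"
      using holomorphic_on_ball_tendsto_0[OF g(4,2)] holomorphic_on_ball_tendsto_0[OF a(1) \<open>r > 0\<close>]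
      by (auto simp only: intro!: tendsto_mult tendsto_ident_at)
    have "g w = w * a w" if "w \<in> ball 0 s" "w \<noteq> 0" for w
      using g(5)[OF that(1)] a(2)[of w] g(3) that by auto
    then have "\<forall>\<^sub>F w in at 0. g w = w * a w"
      using g(2) by (auto simp: eventually_at intro!: exI[of _ s])
    then have "g \<midarrow>0\<rightarrow> 0 * a 0" using lim(2) tendsto_cong by fast
    then have "g 0 = 0 * a 0" using lim(1) LIM_unique by blast
    then show False using g(2) g(6)[of 0] by simp
  qed
  then show ?thesis using f0 x \<open>r > 0\<close> unfolding constant_on_def by (metis centre_in_ball)
qed

text \<open>Nonlinear terms do not reach the leading order: the two points differ by a multiple of
  \<open>x ^ m\<close>, and the Lipschitz constant of \<open>k\<close> is arbitrarily small near
  0.\<close>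

lemma vanish2_difference_quotient:
  fixes \<phi>1 \<phi>2 \<psi>1 \<psi>2 :: "complex \<Rightarrow> complex"
  assumes k: "holo3_on k U" "open U" "0 \<in> U" "vanish2 k"
    and lim: "\<phi>1 \<midarrow>0\<rightarrow> 0" "\<phi>2 \<midarrow>0\<rightarrow> 0" "\<psi>1 \<midarrow>0\<rightarrow> 0" "\<psi>2 \<midarrow>0\<rightarrow> 0"
    and \<alpha>: "\<alpha> \<midarrow>0\<rightarrow> \<alpha>0" "\<forall>\<^sub>F x in at 0. \<phi>1 x - \<phi>2 x = x ^ m * \<alpha> x"
    and \<beta>: "\<beta> \<midarrow>0\<rightarrow> \<beta>0" "\<forall>\<^sub>F x in at 0. \<psi>1 x - \<psi>2 x = x ^ m * \<beta> x"
  shows "(\<lambda>x. (k (x, \<phi>1 x, \<psi>1 x) - k (x, \<phi>2 x, \<psi>2 x)) / x ^ m) \<midarrow>0\<rightarrow> 0"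
proof (rule tendstoI)
  fix e :: real assume "e > 0"
  \<comment> \<open>A strict bound for \<open>|\<alpha> x| + |\<beta> x|\<close> near 0; the
    Lipschitz constant \<open>e / B\<close> is chosen to compensate it.\<close>
  define B where "B = norm \<alpha>0 + norm \<beta>0 + 1"
  have "B > 0" by (simp add: B_def add_nonneg_pos)
  have "(\<lambda>x. norm (\<alpha> x) + norm (\<beta> x)) \<midarrow>0\<rightarrow> norm \<alpha>0 + norm \<beta>0"
    using \<alpha>(1) \<beta>(1) by (intro tendsto_add tendsto_norm)
  then have evB: "\<forall>\<^sub>F x in at 0. norm (\<alpha> x) + norm (\<beta> x) < B"
    by (rule order_tendstoD) (simp add: B_def)
  obtain \<delta> where "\<delta> > 0"
    and lip: "\<And>p q. p \<in> ball 0 \<delta> \<Longrightarrow> q \<in> ball 0 \<delta> \<Longrightarrow> norm (k p - k q) \<le> e / B * norm (p - q)"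
    using vanish2_lipschitz[OF k divide_pos_pos[OF \<open>e > 0\<close> \<open>B > 0\<close>]] by blast
  have near: "\<forall>\<^sub>F x in at 0. (x, \<phi> x, \<psi> x) \<in> ball 0 \<delta>"
    if "\<phi> \<midarrow>0\<rightarrow> 0" "\<psi> \<midarrow>0\<rightarrow> 0" for \<phi> \<psi> :: "complex \<Rightarrow> complex"
  proof (rule topological_tendstoD)
    show "((\<lambda>x. (x, \<phi> x, \<psi> x)) \<longlongrightarrow> (0, 0, 0)) (at 0)"
      using that by (intro tendsto_Pair tendsto_ident_at)
    show "(0, 0, 0) \<in> ball (0::c3) \<delta>" using \<open>\<delta> > 0\<close> by (simp add: zero_prod_def)
  qed simp
  have "\<forall>\<^sub>F x::complex in at 0. x \<noteq> 0" by (simp add: eventually_at_filter)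
  with evB near[OF lim(1,3)] near[OF lim(2,4)] \<alpha>(2) \<beta>(2)
  show "\<forall>\<^sub>F x in at 0. dist ((k (x, \<phi>1 x, \<psi>1 x) - k (x, \<phi>2 x, \<psi>2 x)) / x ^ m) 0 < e"
  proof eventually_elim
    case (elim x)
    have "norm (k (x, \<phi>1 x, \<psi>1 x) - k (x, \<phi>2 x, \<psi>2 x)) \<le>
        e / B * norm ((x, \<phi>1 x, \<psi>1 x) - (x, \<phi>2 x, \<psi>2 x))"
      using lip elim(2,3) .
    also have "norm ((x, \<phi>1 x, \<psi>1 x) - (x, \<phi>2 x, \<psi>2 x)) \<le> norm (x ^ m * \<alpha> x) + norm (x ^ m * \<beta> x)"
      using norm_triple_le[of 0 "\<phi>1 x - \<phi>2 x" "\<psi>1 x - \<psi>2 x"] elim(4,5) by simp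
    also have "\<dots> = norm (x ^ m) * (norm (\<alpha> x) + norm (\<beta> x))" by (simp add: norm_mult algebra_simps)
    finally have "norm (k (x, \<phi>1 x, \<psi>1 x) - k (x, \<phi>2 x, \<psi>2 x)) \<le>
        e / B * (norm (x ^ m) * (norm (\<alpha> x) + norm (\<beta> x)))"
      using \<open>e > 0\<close> \<open>B > 0\<close> by (simp add: mult_left_mono divide_right_mono)
    also have "\<dots> < e / B * (norm (x ^ m) * B)"
      using elim(1,6) \<open>e > 0\<close> \<open>B > 0\<close> by (intro mult_strict_left_mono) auto
    also have "\<dots> = e * norm (x ^ m)" using \<open>B > 0\<close> by simp
    finally show ?case using elim(6) by (simp add: norm_divide divide_less_eq)
  qed
qed

text \<open>If two invariant graphs agree to order \<open>m\<close>, comparing coefficients of \<open>x ^ m\<close> in the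
  invariance equation of one component, whose eigenvalue is \<open>\<mu>\<close>, forces agreement to order \<open>m + 1\<close>.\<close>
lemma invariance_leading_coefficient:
  fixes c1 c2 k1 k2 :: "complex \<Rightarrow> complex"
  assumes "r > 0" and \<eta>: "\<eta>1 holomorphic_on ball 0 r" "\<eta>2 holomorphic_on ball 0 r" "deriv \<eta>2 0 = 0"
    and eq: "\<And>x. x \<in> ball 0 r \<Longrightarrow> c1 x * deriv \<eta>1 x = \<mu> * \<eta>1 x + k1 x"
       "\<And>x. x \<in> ball 0 r \<Longrightarrow> c2 x * deriv \<eta>2 x = \<mu> * \<eta>2 x + k2 x"
    and c: "(\<lambda>x. c1 x / x) \<midarrow>0\<rightarrow> \<nu>" "(\<lambda>x. (c1 x - c2 x) / x ^ m) \<midarrow>0\<rightarrow> l"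
    and k: "(\<lambda>x. (k1 x - k2 x) / x ^ m) \<midarrow>0\<rightarrow> 0"
    and \<gamma>: "\<gamma> holomorphic_on ball 0 r" "\<And>x. x \<in> ball 0 r \<Longrightarrow> \<eta>1 x - \<eta>2 x = x ^ m * \<gamma> x"
  shows "(\<nu> * of_nat m - \<mu>) * \<gamma> 0 = 0"
proof -
  \<comment> \<open>The difference of the two equations divided by \<open>x ^ m\<close>, with
    \<open>\<eta>1 - \<eta>2\<close> written as \<open>x ^ m * \<gamma>\<close>. It vanishes off 0,
    so its limit does. The change of the coefficient from \<open>c1\<close> to \<open>c2\<close> is
    itself of order \<open>m\<close>, but drops out in the limit because it multiplies
    \<open>deriv \<eta>2\<close>, which tends to 0.\<close>
  let ?A = "\<lambda>x. c1 x / x * (of_nat m * \<gamma> x + x * deriv \<gamma> x) + (c1 x - c2 x) / x ^ m * deriv \<eta>2 x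
     - \<mu> * \<gamma> x - (k1 x - k2 x) / x ^ m"
  have "?A \<midarrow>0\<rightarrow> \<nu> * (of_nat m * \<gamma> 0 + 0 * deriv \<gamma> 0) + l * deriv \<eta>2 0 - \<mu> * \<gamma> 0 - 0"
    by (intro tendsto_intros c k holomorphic_on_ball_tendsto_0[OF _ \<open>r > 0\<close>] \<gamma>(1)
        holomorphic_deriv[OF _ open_ball] \<eta>)
  then have lim: "?A \<midarrow>0\<rightarrow> (\<nu> * of_nat m - \<mu>) * \<gamma> 0" by (simp add: \<eta>(3) algebra_simps)
  have A0: "?A x = 0" if x: "x \<in> ball 0 r" "x \<noteq> 0" for x
  proof -
    have "((\<lambda>x. x ^ m * \<gamma> x) has_field_derivative (of_nat m * x ^ (m - 1) * \<gamma> x + x ^ m * deriv \<gamma> x)) (at x)"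
      using holomorphic_derivI[OF \<gamma>(1) open_ball x(1)] by (auto intro!: derivative_eq_intros)
    moreover have "\<forall>\<^sub>F x in nhds x. \<eta>1 x - \<eta>2 x = x ^ m * \<gamma> x"
      using eventually_nhds_in_open[OF open_ball x(1)] by (rule eventually_mono) (rule \<gamma>(2))
    ultimately have "((\<lambda>x. \<eta>1 x - \<eta>2 x) has_field_derivative
        (of_nat m * x ^ (m - 1) * \<gamma> x + x ^ m * deriv \<gamma> x)) (at x)"
      by (subst DERIV_cong_ev[OF refl _ refl])
    moreover have "((\<lambda>x. \<eta>1 x - \<eta>2 x) has_field_derivative (deriv \<eta>1 x - deriv \<eta>2 x)) (at x)"
      using \<eta> x by (intro DERIV_diff holomorphic_derivI[OF _ open_ball])
    ultimately have d: "deriv \<eta>1 x - deriv \<eta>2 x = of_nat m * x ^ (m - 1) * \<gamma> x + x ^ m * deriv \<gamma> x"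
      using DERIV_unique by blast
    \<comment> \<open>For \<open>m = 0\<close> the truncated exponent is harmless, as the factor
      \<open>of_nat m\<close> is 0.\<close>
    have xm: "of_nat m * x ^ (m - 1) * x = of_nat m * x ^ m" by (cases m) auto
    have "(deriv \<eta>1 x - deriv \<eta>2 x) * x = (of_nat m * x ^ (m - 1) * x) * \<gamma> x + x ^ m * (x * deriv \<gamma> x)"
      unfolding d by (simp only: ring_distribs ac_simps)
    also have "\<dots> = (of_nat m * \<gamma> x + x * deriv \<gamma> x) * x ^ m"
      unfolding xm by (simp only: ring_distribs ac_simps)
    finally have "c1 x / x * (of_nat m * \<gamma> x + x * deriv \<gamma> x) * x ^ m = c1 x / x * ((deriv \<eta>1 x - deriv \<eta>2 x) * x)"
      by (simp only: mult.assoc)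
    also have "\<dots> = c1 x * (deriv \<eta>1 x - deriv \<eta>2 x)" using x by simp
    finally have 1: "c1 x / x * (of_nat m * \<gamma> x + x * deriv \<gamma> x) * x ^ m = c1 x * (deriv \<eta>1 x - deriv \<eta>2 x)" .
    have "?A x * x ^ m = c1 x * (deriv \<eta>1 x - deriv \<eta>2 x) + (c1 x - c2 x) * deriv \<eta>2 x
        - \<mu> * (x ^ m * \<gamma> x) - (k1 x - k2 x)"
    proof -
      have "(A + p / t * d - \<mu> * s - q / t) * t = A * t + p * d - \<mu> * (t * s) - q" if "t \<noteq> 0" for A p q d s t
        using that by (simp add: field_simps)
      from this[of "x ^ m"] show ?thesis using x(2) unfolding 1[symmetric] by simp
    qed
    also have "\<dots> = 0"
      unfolding \<gamma>(2)[OF x(1), symmetric] using eq[OF x(1)] by (simp add: algebra_simps)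
    finally show ?thesis using x(2) by simp
  qed
  then have "\<forall>\<^sub>F x in at 0. ?A x = 0"
    using \<open>r > 0\<close> unfolding eventually_at by (intro exI[of _ r]) (simp add: dist_norm)
  then have "?A \<midarrow>0\<rightarrow> 0" by (rule tendsto_eventually)
  with lim show ?thesis using LIM_unique by blast
qed

text \<open>Both components are raised in order together, since each nonlinear term depends on both.
  Agreement to every order then gives equality by the identity theorem.\<close>

lemma x_center_manifold_unique:
  assumes "w \<noteq> 0" "Re lam \<noteq> 0" and U: "open U" "0 \<in> U"
    and holo: "holo3_on f U" "holo3_on g U" "holo3_on h U"
    and van: "vanish2 f" "vanish2 g" "vanish2 h"
    and M1: "x_center_manifold (sys w lam f g h) U r1 \<phi>1 \<psi>1"
    and M2: "x_center_manifold (sys w lam f g h) U r2 \<phi>2 \<psi>2"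
  shows "\<exists>\<epsilon>>0. \<forall>x\<in>ball 0 \<epsilon>. \<phi>1 x = \<phi>2 x \<and> \<psi>1 x = \<psi>2 x"
proof -
  define r where "r = min r1 r2"
  have "r > 0" using M1 M2 by (simp add: r_def x_center_manifold_def)
  have sub: "ball 0 r \<subseteq> ball (0::complex) r1" "ball 0 r \<subseteq> ball (0::complex) r2" by (auto simp: r_def)
  have hol: "\<phi>1 holomorphic_on ball 0 r" "\<psi>1 holomorphic_on ball 0 r"
     "\<phi>2 holomorphic_on ball 0 r" "\<psi>2 holomorphic_on ball 0 r"
    using M1 M2 sub unfolding x_center_manifold_def by (meson holomorphic_on_subset)+
  have at0: "\<phi>1 0 = 0" "\<psi>1 0 = 0" "deriv \<phi>1 0 = 0" "deriv \<psi>1 0 = 0"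
     "\<phi>2 0 = 0" "\<psi>2 0 = 0" "deriv \<phi>2 0 = 0" "deriv \<psi>2 0 = 0"
    using M1 M2 unfolding x_center_manifold_def by auto
  \<comment> \<open>The first component of the field on the graph; tangency forces the scalar in the
    invariance condition to be this function.\<close>
  define c where "c \<phi> \<psi> x = \<i> * of_real w * x + \<phi> x + f (x, \<phi> x, \<psi> x)" for \<phi> \<psi> and x :: complex
  have inv: "c \<phi> \<psi> x * deriv \<phi> x = \<i> * of_real w * \<phi> x + g (x, \<phi> x, \<psi> x)"
     "c \<phi> \<psi> x * deriv \<psi> x = lam * \<psi> x + h (x, \<phi> x, \<psi> x)"
    if "x_center_manifold (sys w lam f g h) U r' \<phi> \<psi>" "x \<in> ball 0 r'" for r' \<phi> \<psi> x
    using that unfolding x_center_manifold_def sys_def c_def by force+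
  have tend0: "\<phi>1 \<midarrow>0\<rightarrow> 0" "\<phi>2 \<midarrow>0\<rightarrow> 0" "\<psi>1 \<midarrow>0\<rightarrow> 0" "\<psi>2 \<midarrow>0\<rightarrow> 0"
    using holomorphic_on_ball_tendsto_0[OF hol(1) \<open>r > 0\<close>] holomorphic_on_ball_tendsto_0[OF hol(2) \<open>r > 0\<close>]
      holomorphic_on_ball_tendsto_0[OF hol(3) \<open>r > 0\<close>] holomorphic_on_ball_tendsto_0[OF hol(4) \<open>r > 0\<close>]
    by (simp_all add: at0)
  have c_lim: "(\<lambda>x. c \<phi>1 \<psi>1 x / x) \<midarrow>0\<rightarrow> \<i> * of_real w"
  proof -
    have "0 \<in> ball (0::complex) r" using \<open>r > 0\<close> by simp
    then have d: "(\<phi>1 has_field_derivative 0) (at 0)" "(\<psi>1 has_field_derivative 0) (at 0)"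
      using holomorphic_derivI[OF hol(1) open_ball] holomorphic_derivI[OF hol(2) open_ball] at0 by metis+
    then have "((\<lambda>x. f (x, \<phi>1 x, \<psi>1 x)) has_field_derivative 0) (at 0)"
      using at0 by (intro vanish2_compose_deriv[OF van(1)]) (auto intro: DERIV_ident)
    then have "(c \<phi>1 \<psi>1 has_field_derivative (\<i> * of_real w * 1 + 0 + 0)) (at 0)"
      unfolding c_def using d(1) by (intro DERIV_add DERIV_cmult DERIV_ident)
    moreover have "c \<phi>1 \<psi>1 0 = 0" using van(1) at0 by (simp add: c_def vanish2_def zero_prod_def)
    ultimately show ?thesis by (simp add: has_field_derivative_iff)
  qed
  \<comment> \<open>The induction starts at order 2, which tangency of both graphs to the
    \<open>x\<close>-axis provides.\<close>
  have agree: "\<exists>\<alpha> \<beta>. \<alpha> holomorphic_on ball 0 r \<and> \<beta> holomorphic_on ball 0 r \<and>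
     (\<forall>x\<in>ball 0 r. \<phi>1 x - \<phi>2 x = x ^ (n + 2) * \<alpha> x \<and> \<psi>1 x - \<psi>2 x = x ^ (n + 2) * \<beta> x)" for n
  proof (induction n)
    case 0
    have "\<exists>b. b holomorphic_on ball 0 r \<and> (\<forall>x\<in>ball 0 r. \<eta>1 x - \<eta>2 x = x ^ 2 * b x)"
      if \<eta>: "\<eta>1 holomorphic_on ball 0 r" "\<eta>2 holomorphic_on ball 0 r" "\<eta>1 0 = 0" "\<eta>2 0 = 0"
        "deriv \<eta>1 0 = 0" "deriv \<eta>2 0 = 0" for \<eta>1 \<eta>2
    proof -
      have h: "(\<lambda>x. \<eta>1 x - \<eta>2 x) holomorphic_on ball 0 r" using \<eta> by (intro holomorphic_on_diff)
      have d: "((\<lambda>x. \<eta>1 x - \<eta>2 x) has_field_derivative (deriv \<eta>1 0 - deriv \<eta>2 0)) (at 0)"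
        using \<eta> \<open>r > 0\<close> by (intro DERIV_diff holomorphic_derivI[OF _ open_ball]) auto
      obtain a where a: "a holomorphic_on ball 0 r" "\<And>x. x \<in> ball 0 r \<Longrightarrow> \<eta>1 x - \<eta>2 x = x * a x"
         "a 0 = deriv (\<lambda>x. \<eta>1 x - \<eta>2 x) 0"
        by (rule holomorphic_on_ball_factor[OF h]) (use \<eta> \<open>r > 0\<close> in auto)
      have "a 0 = 0" using a(3) DERIV_imp_deriv[OF d] \<eta> by simp
      then obtain b where b: "b holomorphic_on ball 0 r" "\<And>x. x \<in> ball 0 r \<Longrightarrow> a x = x * b x"
        using holomorphic_on_ball_factor[OF a(1)] \<open>r > 0\<close> by blast
      then show ?thesis using a(2) by (auto simp: power2_eq_square intro!: exI[of _ b])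
    qed
    from this[of \<phi>1 \<phi>2] this[of \<psi>1 \<psi>2] show ?case using hol at0 by (auto simp: numeral_2_eq_2)
  next
    case (Suc n)
    let ?m = "n + 2"
    obtain \<alpha> \<beta> where \<alpha>\<beta>: "\<alpha> holomorphic_on ball 0 r" "\<beta> holomorphic_on ball 0 r"
      and eqs: "\<And>x. x \<in> ball 0 r \<Longrightarrow> \<phi>1 x - \<phi>2 x = x ^ ?m * \<alpha> x"
        "\<And>x. x \<in> ball 0 r \<Longrightarrow> \<psi>1 x - \<psi>2 x = x ^ ?m * \<beta> x"
      using Suc by blast
    have ev: "\<forall>\<^sub>F x in at 0. \<phi>1 x - \<phi>2 x = x ^ ?m * \<alpha> x" "\<forall>\<^sub>F x in at 0. \<psi>1 x - \<psi>2 x = x ^ ?m * \<beta> x"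
      using eqs \<open>r > 0\<close> unfolding eventually_at by (auto simp: dist_norm intro!: exI[of _ r])
    note lims = holomorphic_on_ball_tendsto_0[OF \<alpha>\<beta>(1) \<open>r > 0\<close>] holomorphic_on_ball_tendsto_0[OF \<alpha>\<beta>(2) \<open>r > 0\<close>]
    have q: "(\<lambda>x. (k (x, \<phi>1 x, \<psi>1 x) - k (x, \<phi>2 x, \<psi>2 x)) / x ^ ?m) \<midarrow>0\<rightarrow> 0"
      if "holo3_on k U" "vanish2 k" for k
      by (rule vanish2_difference_quotient[OF that(1) U that(2) tend0 lims(1) ev(1) lims(2) ev(2)])
    have nz: "\<forall>\<^sub>F x::complex in at 0. x \<noteq> 0" by (simp add: eventually_at_filter)
    \<comment> \<open>Because of the term \<open>y\<close> in the first equation, the coefficients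
      \<open>c\<close> differ at order \<open>?m\<close> itself, with leading coefficient
      \<open>\<alpha> 0\<close>; the limit need not be 0.\<close>
    have "(\<lambda>x. \<alpha> x + (f (x, \<phi>1 x, \<psi>1 x) - f (x, \<phi>2 x, \<psi>2 x)) / x ^ ?m) \<midarrow>0\<rightarrow> \<alpha> 0 + 0"
      by (intro tendsto_add lims q holo van)
    moreover have "\<forall>\<^sub>F x in at 0. \<alpha> x + (f (x, \<phi>1 x, \<psi>1 x) - f (x, \<phi>2 x, \<psi>2 x)) / x ^ ?m
       = (c \<phi>1 \<psi>1 x - c \<phi>2 \<psi>2 x) / x ^ ?m"
      using nz ev(1)
    proof eventually_elim
      case (elim x)
      have "c \<phi>1 \<psi>1 x - c \<phi>2 \<psi>2 x = x ^ ?m * \<alpha> x + (f (x, \<phi>1 x, \<psi>1 x) - f (x, \<phi>2 x, \<psi>2 x))"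
        unfolding elim(2)[symmetric] c_def by simp
      then show ?case using elim(1) by (simp only: add_divide_distrib) simp
    qed
    ultimately have cd: "(\<lambda>x. (c \<phi>1 \<psi>1 x - c \<phi>2 \<psi>2 x) / x ^ ?m) \<midarrow>0\<rightarrow> \<alpha> 0 + 0"
      by (rule Lim_transform_eventually)
    have inv1: "c \<phi>1 \<psi>1 x * deriv \<phi>1 x = \<i> * of_real w * \<phi>1 x + g (x, \<phi>1 x, \<psi>1 x)"
      "c \<phi>1 \<psi>1 x * deriv \<psi>1 x = lam * \<psi>1 x + h (x, \<phi>1 x, \<psi>1 x)"
      "c \<phi>2 \<psi>2 x * deriv \<phi>2 x = \<i> * of_real w * \<phi>2 x + g (x, \<phi>2 x, \<psi>2 x)"
      "c \<phi>2 \<psi>2 x * deriv \<psi>2 x = lam * \<psi>2 x + h (x, \<phi>2 x, \<psi>2 x)" if "x \<in> ball 0 r" for x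
      using inv[OF M1, of x] inv[OF M2, of x] that sub by auto
    have "(\<i> * of_real w * of_nat ?m - \<i> * of_real w) * \<alpha> 0 = 0"
      by (rule invariance_leading_coefficient[OF \<open>r > 0\<close> hol(1,3) at0(7) inv1(1,3) c_lim cd
            q[OF holo(2) van(2)] \<alpha>\<beta>(1) eqs(1)])
    \<comment> \<open>Order \<open>n + 2\<close> minus the resonant degree 1 leaves the positive
      factor \<open>Suc n\<close>.\<close>
    moreover have "\<i> * of_real w * of_nat ?m - \<i> * of_real w = \<i> * of_real w * of_nat (Suc n)"
      by (simp add: algebra_simps)
    ultimately have "\<alpha> 0 = 0" using \<open>w \<noteq> 0\<close> by (simp del: of_nat_Suc)
    have "(\<i> * of_real w * of_nat ?m - lam) * \<beta> 0 = 0"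
      by (rule invariance_leading_coefficient[OF \<open>r > 0\<close> hol(2,4) at0(8) inv1(2,4) c_lim cd
            q[OF holo(3) van(3)] \<alpha>\<beta>(2) eqs(2)])
    moreover have "Re (\<i> * of_real w * of_nat ?m - lam) \<noteq> 0" using \<open>Re lam \<noteq> 0\<close> by simp
    ultimately have "\<beta> 0 = 0" by (metis mult_eq_0_iff zero_complex.sel(1))
    obtain \<alpha>' where \<alpha>': "\<alpha>' holomorphic_on ball 0 r" "\<And>x. x \<in> ball 0 r \<Longrightarrow> \<alpha> x = x * \<alpha>' x"
      using holomorphic_on_ball_factor[OF \<alpha>\<beta>(1) \<open>\<alpha> 0 = 0\<close> \<open>r > 0\<close>] by blast
    obtain \<beta>' where \<beta>': "\<beta>' holomorphic_on ball 0 r" "\<And>x. x \<in> ball 0 r \<Longrightarrow> \<beta> x = x * \<beta>' x"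
      using holomorphic_on_ball_factor[OF \<alpha>\<beta>(2) \<open>\<beta> 0 = 0\<close> \<open>r > 0\<close>] by blast
    show ?case using \<alpha>' \<beta>' eqs by (intro exI[of _ \<alpha>'] exI[of _ \<beta>']) simp
  qed
  have flat: "\<exists>a. a holomorphic_on ball 0 r \<and> (\<forall>x\<in>ball 0 r. \<phi>1 x - \<phi>2 x = x ^ m * a x)"
    "\<exists>a. a holomorphic_on ball 0 r \<and> (\<forall>x\<in>ball 0 r. \<psi>1 x - \<psi>2 x = x ^ m * a x)" for m
  proof -
    obtain \<alpha> \<beta> where ab: "\<alpha> holomorphic_on ball 0 r" "\<beta> holomorphic_on ball 0 r"
     "\<And>x. x \<in> ball 0 r \<Longrightarrow> \<phi>1 x - \<phi>2 x = x ^ (m + 2) * \<alpha> x \<and> \<psi>1 x - \<psi>2 x = x ^ (m + 2) * \<beta> x"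
      using agree[of m] by blast
    show "\<exists>a. a holomorphic_on ball 0 r \<and> (\<forall>x\<in>ball 0 r. \<phi>1 x - \<phi>2 x = x ^ m * a x)"
      using ab by (intro exI[of _ "\<lambda>x. x ^ 2 * \<alpha> x"]) (simp add: power_add power2_eq_square holomorphic_intros)
    show "\<exists>a. a holomorphic_on ball 0 r \<and> (\<forall>x\<in>ball 0 r. \<psi>1 x - \<psi>2 x = x ^ m * a x)"
      using ab by (intro exI[of _ "\<lambda>x. x ^ 2 * \<beta> x"]) (simp add: power_add power2_eq_square holomorphic_intros)
  qed
  have "\<phi>1 x = \<phi>2 x \<and> \<psi>1 x = \<psi>2 x" if "x \<in> ball 0 r" for x
    using holomorphic_flat_eq_0[OF holomorphic_on_diff[OF hol(1,3)] flat(1) that]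
      holomorphic_flat_eq_0[OF holomorphic_on_diff[OF hol(2,4)] flat(2) that] by simp
  then show ?thesis using \<open>r > 0\<close> by blast
qed

section \<open>The isochronous family\<close>

text \<open>The parametrized curve becomes a graph by inverting \<open>X\<close> near 0, where its
  derivative is 1: with the inverse \<open>G\<close>, the graph functions are \<open>Y\<close> and
  \<open>Z\<close> composed with \<open>G\<close>.\<close>

lemma x_center_manifold_exists:
  assumes "w \<noteq> 0" "Re lam \<noteq> 0" and U: "open U" "0 \<in> U"
    and holo: "holo3_on f U" "holo3_on g U" "holo3_on h U"
    and van: "vanish2 f" "vanish2 g" "vanish2 h"
  shows "\<exists>r \<phi> \<psi>. x_center_manifold (sys w lam f g h) U r \<phi> \<psi> \<and>
            isochronous_family (sys w lam f g h) U (graph3 r \<phi> \<psi>) (2 * pi / \<bar>w\<bar>)"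
proof -
  let ?F = "sys w lam f g h"
  obtain r0 X Y Z where r0: "r0 > 0"
    and hol: "X holomorphic_on ball 0 r0" "Y holomorphic_on ball 0 r0" "Z holomorphic_on ball 0 r0"
    and at0: "X 0 = 0" "Y 0 = 0" "Z 0 = 0" "deriv X 0 = 1" "deriv Y 0 = 0" "deriv Z 0 = 0"
    and inU0: "\<And>x. x \<in> ball 0 r0 \<Longrightarrow> (X x, Y x, Z x) \<in> U"
    and eq0: "\<And>x. x \<in> ball 0 r0 \<Longrightarrow> ?F (X x, Y x, Z x) =
       (\<i> * of_real w * x * deriv X x, \<i> * of_real w * x * deriv Y x, \<i> * of_real w * x * deriv Z x)"
    by (rule linearizing_parametrization[OF assms]) (rule that)
  obtain \<rho> where \<rho>: "\<rho> > 0" "ball (0::complex) \<rho> \<subseteq> ball 0 r0" "inj_on X (ball 0 \<rho>)"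
    by (rule has_complex_derivative_locally_injective[OF hol(1), of 0]) (use r0 at0 in auto)
  let ?B = "ball (0::complex) \<rho>"
  note hol = hol[THEN holomorphic_on_subset, OF \<rho>(2)]
  have inU: "(X x, Y x, Z x) \<in> U" if "x \<in> ?B" for x using inU0 \<rho>(2) that by blast
  have eq: "?F (X x, Y x, Z x) =
       (\<i> * of_real w * x * deriv X x, \<i> * of_real w * x * deriv Y x, \<i> * of_real w * x * deriv Z x)"
    if "x \<in> ?B" for x using eq0 \<rho>(2) that by blast
  obtain G where G: "G holomorphic_on X ` ?B" "\<And>z. z \<in> ?B \<Longrightarrow> deriv X z * deriv G (X z) = 1"
     "\<And>z. z \<in> ?B \<Longrightarrow> G (X z) = z"
    using holomorphic_has_inverse[OF hol(1) open_ball \<rho>(3)] by blast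
  have "open (X ` ?B)" using open_mapping_thm3[OF hol(1) open_ball \<rho>(3)] .
  moreover have "0 \<in> X ` ?B" using at0 \<rho>(1) by (metis centre_in_ball imageI)
  ultimately obtain R where R: "R > 0" "ball 0 R \<subseteq> X ` ?B" using open_contains_ball by blast
  have GB: "G x \<in> ?B" "X (G x) = x" if "x \<in> ball 0 R" for x
    using that R(2) G(3) by (metis (no_types, lifting) imageE subsetD)+
  have holG: "G holomorphic_on ball 0 R" using G(1) R(2) by (rule holomorphic_on_subset)
  have G0: "G 0 = 0" using G(3)[of 0] at0 \<rho>(1) by simp
  have dG: "deriv X (G x) * deriv G x = 1" if "x \<in> ball 0 R" for x
    using G(2)[OF GB(1)[OF that]] GB(2)[OF that] by simp
  have deriv_comp: "deriv (\<lambda>x. k (G x)) x = deriv k (G x) * deriv G x"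
    if "k holomorphic_on ?B" "x \<in> ball 0 R" for k x
    by (intro DERIV_imp_deriv DERIV_chain2 holomorphic_derivI[OF that(1) open_ball]
        holomorphic_derivI[OF holG open_ball] GB that)
  have hol_comp: "(\<lambda>x. k (G x)) holomorphic_on ball 0 R" if "k holomorphic_on ?B" for k
    using holomorphic_on_compose_gen[OF holG that] GB(1) unfolding o_def by blast
  define \<phi> where "\<phi> x = Y (G x)" for x
  define \<psi> where "\<psi> x = Z (G x)" for x
  have graph: "(x, \<phi> x, \<psi> x) = (X (G x), Y (G x), Z (G x))" if "x \<in> ball 0 R" for x
    using GB(2)[OF that] by (simp add: \<phi>_def \<psi>_def)
  have "x_center_manifold ?F U R \<phi> \<psi>"
    unfolding x_center_manifold_def
  proof (intro conjI ballI)
    show "\<phi> holomorphic_on ball 0 R" "\<psi> holomorphic_on ball 0 R"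
      unfolding \<phi>_def \<psi>_def using hol by (auto intro!: hol_comp)
    show "\<phi> 0 = 0" "\<psi> 0 = 0" by (simp_all add: \<phi>_def \<psi>_def G0 at0)
    show "deriv \<phi> 0 = 0" "deriv \<psi> 0 = 0"
      unfolding \<phi>_def \<psi>_def using deriv_comp[OF hol(2), of 0] deriv_comp[OF hol(3), of 0] R(1)
      by (simp_all add: G0 at0)
    show "graph3 R \<phi> \<psi> \<subseteq> U"
      unfolding graph3_def by (rule image_subsetI) (metis graph inU GB(1))
    fix x :: complex assume x: "x \<in> ball 0 R"
    let ?c = "\<i> * of_real w * G x * deriv X (G x)"
    have "?c * (k * deriv G x) = \<i> * of_real w * G x * k * (deriv X (G x) * deriv G x)" for k
      by (simp only: ac_simps)
    \<comment> \<open>The chain rule factor \<open>deriv G\<close> cancels \<open>deriv X\<close>,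
      so \<open>?c\<close> times the slope of the graph is exactly the component of the field along
      the parametrization.\<close>
    then have c: "?c * (k * deriv G x) = \<i> * of_real w * G x * k" for k by (simp add: dG[OF x])
    have "?F (x, \<phi> x, \<psi> x) = (?c, ?c * deriv \<phi> x, ?c * deriv \<psi> x)"
      unfolding graph[OF x] eq[OF GB(1)[OF x]]
      unfolding \<phi>_def \<psi>_def deriv_comp[OF hol(2) x] deriv_comp[OF hol(3) x] c ..
    then show "\<exists>c. ?F (x, \<phi> x, \<psi> x) = (c, c * deriv \<phi> x, c * deriv \<psi> x)" by blast
  qed (rule R(1))
  \<comment> \<open>Any radius would serve in place of 1: every point of the graph is a parametrized
    point, and the parameter disc is invariant under rotation. A trajectory may leave the graph over
    \<open>ball 0 R\<close>, but it stays on the image of the disc \<open>?B\<close>, which lies in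
    \<open>U\<close>.\<close>
  moreover have "isochronous_family ?F U (graph3 R \<phi> \<psi>) (2 * pi / \<bar>w\<bar>)"
    unfolding isochronous_family_def
  proof (intro exI[of _ "1::real"] conjI ballI impI)
    fix p assume "p \<in> graph3 R \<phi> \<psi>" and p0: "p \<noteq> 0 \<and> norm p < 1"
    then obtain x where x: "x \<in> ball 0 R" and p: "p = (x, \<phi> x, \<psi> x)" by (auto simp: graph3_def)
    define \<xi> where "\<xi> = G x"
    have \<xi>: "\<xi> \<in> ?B" "p = (X \<xi>, Y \<xi>, Z \<xi>)" using GB(1)[OF x] graph[OF x] by (simp_all add: \<xi>_def p)
    have "\<xi> \<noteq> 0" using p0 \<xi>(2) at0 by (auto simp: zero_prod_def)
    define e where "e t = exp (\<i> * of_real w * of_real t) * \<xi>" for t :: real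
    define u where "u t = (X (e t), Y (e t), Z (e t))" for t
    have eB: "e t \<in> ?B" for t using \<xi>(1) by (simp add: e_def norm_mult)
    have u0: "u 0 = p" by (simp add: u_def e_def \<xi>)
    have comp: "((\<lambda>t. k (e t)) has_vector_derivative (\<i> * of_real w * e t * deriv k (e t))) (at t)"
      if "k holomorphic_on ?B" for k t
    proof -
      have "((\<lambda>z. k (exp (\<i> * of_real w * z) * \<xi>)) has_field_derivative
          deriv k (exp (\<i> * of_real w * of_real t) * \<xi>) * (\<i> * of_real w * (exp (\<i> * of_real w * of_real t) * \<xi>)))
          (at (of_real t))"
        using eB[of t, unfolded e_def]
        by (intro DERIV_chain2[where f = k] holomorphic_derivI[OF that open_ball])
           (auto intro!: derivative_eq_intros)
      from has_vector_derivative_real_field[OF this] show ?thesis by (simp add: e_def mult.commute)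
    qed
    have du: "(u has_vector_derivative ?F (u t)) (at t)" for t
      unfolding u_def eq[OF eB] by (intro has_vector_derivative_Pair comp hol)
    have uU: "u t \<in> U" for t unfolding u_def by (rule inU[OF eB])
    show "\<exists>u. u 0 = p \<and> (\<forall>t. u t \<in> U \<and> (u has_vector_derivative ?F (u t)) (at t)) \<and>
         (\<forall>t. u (t + 2 * pi / \<bar>w\<bar>) = u t) \<and> (\<forall>s. 0 < s \<and> s < 2 * pi / \<bar>w\<bar> \<longrightarrow> u s \<noteq> p) \<and>
         (\<forall>v I. is_interval I \<and> 0 \<in> I \<and> v 0 = p \<and>
             (\<forall>t\<in>I. v t \<in> U \<and> (v has_vector_derivative ?F (v t)) (at t within I)) \<longrightarrow> (\<forall>t\<in>I. v t = u t))"
    proof (intro exI[of _ u] conjI allI impI ballI)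
      fix t
      \<comment> \<open>The sign of \<open>w\<close> only decides the direction of the
        rotation.\<close>
      have "w * (2 * pi / \<bar>w\<bar>) = 2 * pi \<or> w * (2 * pi / \<bar>w\<bar>) = - (2 * pi)" using \<open>w \<noteq> 0\<close>
        by (cases "w > 0") auto
      then have "exp (\<i> * of_real (w * (2 * pi / \<bar>w\<bar>))) = 1"
        unfolding cis_conv_exp[symmetric] complex_eq_iff cis.sel one_complex.sel
        by (elim disjE) (simp_all only: cos_minus sin_minus cos_two_pi sin_two_pi minus_zero simp_thms)
      then have "e (t + 2 * pi / \<bar>w\<bar>) = e t"
        by (simp add: e_def ring_distribs exp_add mult.assoc)
      then show "u (t + 2 * pi / \<bar>w\<bar>) = u t" by (simp add: u_def)
    next
      fix s assume s: "0 < s \<and> s < 2 * pi / \<bar>w\<bar>"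
      show "u s \<noteq> p"
      proof
        assume "u s = p"
        then have "X (e s) = X \<xi>" by (simp add: u_def \<xi>(2))
        \<comment> \<open>Injectivity of \<open>X\<close> reduces a return of the trajectory to a
          return of the rotating parameter. Since \<open>\<xi>\<close> is nonzero,
          \<open>w * s\<close> would then be a multiple of \<open>2 * pi\<close>, although
          \<open>|w| * s\<close> lies strictly between 0 and \<open>2 * pi\<close>.\<close>
        then have "e s = \<xi>" using \<rho>(3) eB \<xi>(1) by (meson inj_onD)
        then have "exp (\<i> * of_real (w * s)) = 1" using \<open>\<xi> \<noteq> 0\<close> by (simp add: e_def mult.assoc)
        then obtain n :: int where n: "w * s = of_int (2 * n) * pi" unfolding exp_eq_1 by auto
        then have "\<bar>w\<bar> * s = 2 * pi * \<bar>of_int n\<bar>" using s by (auto simp: abs_mult dest: arg_cong[of _ _ abs])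
        moreover have "\<bar>w\<bar> * s > 0" "\<bar>w\<bar> * s < 2 * pi" using s \<open>w \<noteq> 0\<close> by (auto simp: field_simps)
        ultimately have "0 < \<bar>real_of_int n\<bar>" "\<bar>real_of_int n\<bar> < 1" by (auto simp: zero_less_mult_iff)
        then show False by auto
      qed
    next
      fix v I t assume v: "is_interval I \<and> 0 \<in> I \<and> v 0 = p \<and>
             (\<forall>t\<in>I. v t \<in> U \<and> (v has_vector_derivative ?F (v t)) (at t within I))" and t: "t \<in> I"
      show "v t = u t"
        by (rule ode_solutions_agree[where I = I and ?t0.0 = 0, OF sys_locally_lipschitz[OF U(1) holo]])
           (use v t u0 du in \<open>auto intro: has_vector_derivative_at_within\<close>)
    qed (use u0 du uU in auto)
  qed simp
  ultimately show ?thesis by blast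
qed

theorem theorem3p4:
  fixes w :: real and lam :: complex and f g h :: "c3 \<Rightarrow> complex" and U :: "c3 set"
  assumes "w \<noteq> 0" and "Re lam \<noteq> 0"
    and "open U" and "0 \<in> U"
    and "holo3_on f U" and "holo3_on g U" and "holo3_on h U"
    and "vanish2 f" and "vanish2 g" and "vanish2 h"
  shows "(\<exists>r \<phi> \<psi>. x_center_manifold (sys w lam f g h) U r \<phi> \<psi> \<and>
            isochronous_family (sys w lam f g h) U (graph3 r \<phi> \<psi>) (2 * pi / \<bar>w\<bar>))
       \<and> (\<forall>r1 \<phi>1 \<psi>1 r2 \<phi>2 \<psi>2.
            x_center_manifold (sys w lam f g h) U r1 \<phi>1 \<psi>1 \<and>
            x_center_manifold (sys w lam f g h) U r2 \<phi>2 \<psi>2 \<longrightarrow>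
            (\<exists>\<epsilon>>0. \<forall>x\<in>ball 0 \<epsilon>. \<phi>1 x = \<phi>2 x \<and> \<psi>1 x = \<psi>2 x))"
  using x_center_manifold_exists[OF assms] x_center_manifold_unique[OF assms] by blast

end
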